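(* Let $K$ be a field, $S=K[x_1,x_2,x_3]$, and let $I\subset S$ be a monomial ideal with $I\neq 0$ and $I\neq S$. Then $\operatorname{sdepth}(I)\geq\operatorname{sdepth}(S/I)+1$. In particular, if $\operatorname{sdepth}(I)=1$, then $\operatorname{depth}(I)=1$.
   Context: The depth of a finitely generated graded $S$-module is taken with respect to the maximal ideal $(x_1,x_2,x_3)$. $S$ is given the standard $\mathbb{Z}^3$-grading, with $\deg x_i$ the $i$-th unit vector. Let $M\neq 0$ be a finitely generated $\mathbb{Z}^3$-graded $S$-module. A Stanley decomposition of $M$ is a direct sum decomposition of $K$-vector spaces $\mathcal{D}: M=\bigoplus_{i=1}^r m_iK[Z_i]$ where each $m_i\in M$ is homogeneous, $Z_i\subset\{x_1,x_2,x_3\}$, and $m_iK[Z_i]$ is a free $K[Z_i]$-module. Put $\operatorname{sdepth}(\mathcal{D})=\min_{1\le i\le r}|Z_i|$. The Stanley depth of $M$ is $\operatorname{sdepth}(M)=\max\{\operatorname{sdepth}(\mathcal{D}) : \mathcal{D}\text{ a Stanley decomposition of }M\}$. *)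

theory Defs
  imports
    "HOL-Algebra.Module"
    "HOL-Algebra.QuotRing"
    "HOL-Library.FuncSet"
    "HOL-Library.Poly_Mapping"
    "HOL-Library.Numeral_Type"
    "HOL-Library.Extended_Nat"
begin

text \<open>
  Polynomials over \<open>'k\<close> with variables indexed by the finite type \<open>'v\<close>: an element of
  \<open>'v \<Rightarrow>\<^sub>0 nat\<close> is the exponent vector of a monomial. For \<open>K[x\<^sub>1,x\<^sub>2,x\<^sub>3]\<close> take the
  three-element type \<open>3\<close> for \<open>'v\<close>.
\<close>

type_synonym ('v, 'k) mpoly = "('v \<Rightarrow>\<^sub>0 nat) \<Rightarrow>\<^sub>0 'k"

definition poly_ring :: "('v, 'k::comm_ring_1) mpoly ring" where
  "poly_ring = \<lparr>carrier = UNIV, mult = (*), one = 1, zero = 0, add = (+)\<rparr>"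

definition monomial :: "('v \<Rightarrow>\<^sub>0 nat) \<Rightarrow> ('v, 'k::comm_ring_1) mpoly" where
  "monomial b = Poly_Mapping.single b 1"

definition var :: "'v \<Rightarrow> ('v, 'k::comm_ring_1) mpoly" where
  "var i = monomial (Poly_Mapping.single i 1)"

definition max_ideal :: "('v, 'k::comm_ring_1) mpoly set" where
  "max_ideal = Idl\<^bsub>poly_ring\<^esub> (range var)"

definition monomial_ideal :: "('v, 'k::comm_ring_1) mpoly set \<Rightarrow> bool" where
  "monomial_ideal I \<longleftrightarrow> (\<exists>B. I = Idl\<^bsub>poly_ring\<^esub> (monomial ` B))"

definition subpoly :: "'v set \<Rightarrow> ('v, 'k::comm_ring_1) mpoly set" where
  "subpoly Z = {f. \<forall>b \<in> Poly_Mapping.keys f. Poly_Mapping.keys b \<subseteq> Z}"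


section \<open>An ideal and its quotient as modules\<close>

text \<open>
  The fields \<open>mult\<close> and \<open>one\<close>, inherited by the module record from the ring record, play no
  role in a module.
\<close>

definition ideal_module :: "'a ring \<Rightarrow> 'a set \<Rightarrow> ('a, 'a) module" where
  "ideal_module R I =
    \<lparr>carrier = I, mult = mult R, one = one R, zero = zero R, add = add R, smult = mult R\<rparr>"

definition quotient_module :: "'a ring \<Rightarrow> 'a set \<Rightarrow> ('a, 'a set) module" where
  "quotient_module R I =
    \<lparr>carrier = carrier (R Quot I), mult = mult (R Quot I), one = one (R Quot I),
     zero = zero (R Quot I), add = add (R Quot I),
     smult = (\<lambda>f X. (I +>\<^bsub>R\<^esub> f) \<otimes>\<^bsub>R Quot I\<^esub> X)\<rparr>"


section \<open>Multigradings\<close>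

text \<open>
  A \<open>\<int>\<^sup>n\<close>-grading is given by the family of its homogeneous components, indexed by the
  degrees \<open>'v \<Rightarrow> int\<close>. In the standard grading the component of degree \<open>a\<close> of the polynomial
  ring is spanned by the monomial with exponent vector \<open>a\<close>; it is zero if \<open>a\<close> has a negative
  entry.
\<close>

definition poly_component :: "('v \<Rightarrow> int) \<Rightarrow> ('v, 'k::comm_ring_1) mpoly set" where
  "poly_component a =
    {f. \<forall>b \<in> Poly_Mapping.keys f. \<forall>i. int (Poly_Mapping.lookup b i) = a i}"

definition ideal_component ::
    "('v, 'k::comm_ring_1) mpoly set \<Rightarrow> ('v \<Rightarrow> int) \<Rightarrow> ('v, 'k) mpoly set" where
  "ideal_component I a = I \<inter> poly_component a"

definition quotient_component ::
    "('v, 'k::comm_ring_1) mpoly set \<Rightarrow> ('v \<Rightarrow> int) \<Rightarrow> ('v, 'k) mpoly set set" where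
  "quotient_component I a = (\<lambda>f. I +>\<^bsub>poly_ring\<^esub> f) ` poly_component a"


section \<open>Stanley depth\<close>

text \<open>
  \<open>N\<close> is a free module over the subring \<open>A\<close>: it has a basis. Coefficient functions are
  finitely supported.
\<close>

definition free_over :: "('a, 'm) module \<Rightarrow> 'a ring \<Rightarrow> 'a set \<Rightarrow> 'm set \<Rightarrow> bool" where
  "free_over M R A N \<longleftrightarrow>
    (\<exists>B \<subseteq> N. \<forall>y \<in> N. \<exists>!c. c \<in> B \<rightarrow>\<^sub>E A \<and> finite {b \<in> B. c b \<noteq> \<zero>\<^bsub>R\<^esub>} \<and>
      y = (\<Oplus>\<^bsub>M\<^esub>b\<in>{b \<in> B. c b \<noteq> \<zero>\<^bsub>R\<^esub>}. c b \<odot>\<^bsub>M\<^esub> b))"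

definition direct_sum :: "('a, 'm) module \<Rightarrow> nat \<Rightarrow> (nat \<Rightarrow> 'm set) \<Rightarrow> bool" where
  "direct_sum M r N \<longleftrightarrow>
    (\<forall>i<r. N i \<subseteq> carrier M) \<and>
    (\<forall>y \<in> carrier M. \<exists>!c. c \<in> (\<Pi>\<^sub>E i\<in>{..<r}. N i) \<and> y = (\<Oplus>\<^bsub>M\<^esub>i\<in>{..<r}. c i))"

definition stanley_space ::
    "(('v, 'k::field) mpoly, 'm) module \<Rightarrow> 'm \<Rightarrow> 'v set \<Rightarrow> 'm set" where
  "stanley_space M m Z = (\<lambda>f. f \<odot>\<^bsub>M\<^esub> m) ` subpoly Z"

text \<open>
  A decomposition is the list of the pairs \<open>(m\<^sub>i, Z\<^sub>i)\<close>. The zero module counts as free,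
  so summands with \<open>m\<^sub>i = 0\<close> may occur; omitting them never decreases the minimum of the
  \<open>|Z\<^sub>i|\<close>.
\<close>

definition stanley_decomposition ::
    "(('v::finite, 'k::field) mpoly, 'm) module \<Rightarrow> (('v \<Rightarrow> int) \<Rightarrow> 'm set) \<Rightarrow>
      ('m \<times> 'v set) list \<Rightarrow> bool" where
  "stanley_decomposition M G D \<longleftrightarrow>
    D \<noteq> [] \<and>
    (\<forall>(m, Z) \<in> set D. (\<exists>a. m \<in> G a) \<and>
      free_over M poly_ring (subpoly Z) (stanley_space M m Z)) \<and>
    direct_sum M (length D) (\<lambda>i. stanley_space M (fst (D ! i)) (snd (D ! i)))"

definition sdepth_decomposition :: "('m \<times> 'v::finite set) list \<Rightarrow> nat" where
  "sdepth_decomposition D = Min ((\<lambda>(m, Z). card Z) ` set D)"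

definition sdepth ::
    "(('v::finite, 'k::field) mpoly, 'm) module \<Rightarrow> (('v \<Rightarrow> int) \<Rightarrow> 'm set) \<Rightarrow> nat" where
  "sdepth M G = Max {sdepth_decomposition D | D. stanley_decomposition M G D}"


section \<open>Depth\<close>

definition seq_submodule :: "('a, 'm) module \<Rightarrow> 'a list \<Rightarrow> 'm set" where
  "seq_submodule M fs =
    {\<Oplus>\<^bsub>M\<^esub>j\<in>{..<length fs}. fs ! j \<odot>\<^bsub>M\<^esub> y j | y. y \<in> {..<length fs} \<rightarrow> carrier M}"

text \<open>
  \<open>f\<^sub>1, \<dots>, f\<^sub>r\<close> is \<open>M\<close>-regular if \<open>f\<^sub>i\<close> is a nonzerodivisor on
  \<open>M / (f\<^sub>1, \<dots>, f\<^sub>i\<^sub>-\<^sub>1) M\<close> for all \<open>i\<close>, and \<open>M \<noteq> (f\<^sub>1, \<dots>, f\<^sub>r) M\<close>.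
\<close>

definition regular_sequence :: "('a, 'm) module \<Rightarrow> 'a list \<Rightarrow> bool" where
  "regular_sequence M fs \<longleftrightarrow>
    (\<forall>i<length fs. \<forall>y \<in> carrier M.
      fs ! i \<odot>\<^bsub>M\<^esub> y \<in> seq_submodule M (take i fs) \<longrightarrow> y \<in> seq_submodule M (take i fs)) \<and>
    seq_submodule M fs \<noteq> carrier M"

text \<open>
  The depth with respect to the ideal generated by the variables. The supremum is taken in
  \<^typ>\<open>enat\<close>, where it is meaningful without knowing that the lengths are bounded.
\<close>

definition depth :: "(('v::finite, 'k::field) mpoly, 'm) module \<Rightarrow> enat" where
  "depth M = Sup {enat (length fs) | fs. set fs \<subseteq> max_ideal \<and> regular_sequence M fs}"

end

theory Submission
  imports Defs
begin

text \<open>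
  A partition of the exponents of \<open>I\<close>, or of those outside \<open>I\<close>, into finitely many boxes
  \<open>a + \<nat>\<^sup>Z\<close> is a Stanley decomposition. Conversely, if \<open>u\<close> is an exponent outside \<open>I\<close>, then
  in any Stanley decomposition of \<open>S/I\<close> some summand \<open>m K[Z]\<close> contributes to the degree \<open>u\<close>,
  and freeness keeps the whole box \<open>u + \<nat>\<^sup>Z\<close> outside \<open>I\<close>. Hence \<open>sdepth(S/I) \<ge> 2\<close> forces \<open>I\<close>
  to be principal, and \<open>sdepth(S/I) \<ge> 1\<close> forces \<open>S/I\<close> to have no socle. In the latter case the
  exponents of \<open>I\<close> are partitioned into boxes of dimension at least 2 by slicing them along the
  third axis: the exponents that enter \<open>I\<close> at a given height form a disjoint union of half-lines
  and orthants in the plane. If \<open>sdepth(I) = 1\<close>, then \<open>S/I\<close> has a socle element \<open>u\<close>, and for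
  an \<open>I\<close>-regular sequence \<open>f, g\<close> in the maximal ideal \<open>g (f u) = f (g u) \<in> f I\<close> would give \<open>u \<in> I\<close>.
\<close>

section \<open>Partitions of sets of exponents into boxes\<close>

definition upset :: "('v \<Rightarrow> nat) set \<Rightarrow> bool" where
  "upset T \<longleftrightarrow> (\<forall>u \<in> T. \<forall>v. u \<le> v \<longrightarrow> v \<in> T)"

text \<open>Capping all entries at \<open>N\<close> leaves only finitely many vectors. By
  \<open>upset_trunc\<close>, membership in a given upset survives this for a suitable
  \<open>N\<close>, which is where every finiteness below comes from.\<close>

definition trunc :: "nat \<Rightarrow> ('v \<Rightarrow> nat) \<Rightarrow> 'v \<Rightarrow> nat" where
  "trunc N u = (\<lambda>i. min (u i) N)"

text \<open>These are the exponents of the monomials in x^a K[Z].\<close>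

definition box :: "('v \<Rightarrow> nat) \<Rightarrow> 'v set \<Rightarrow> ('v \<Rightarrow> nat) set" where
  "box a Z = {u. \<forall>i. a i \<le> u i \<and> (i \<notin> Z \<longrightarrow> u i = a i)}"

text \<open>Unique existence of the pair expresses covering and disjointness at once. The pairs are
  kept because the dimension of a box is read off from \<open>Z\<close>.\<close>

definition box_partition :: "(('v \<Rightarrow> nat) \<times> 'v set) set \<Rightarrow> ('v \<Rightarrow> nat) set \<Rightarrow> bool" where
  "box_partition P T \<longleftrightarrow> finite P \<and> (\<forall>(a, Z) \<in> P. box a Z \<subseteq> T) \<and>
     (\<forall>u \<in> T. \<exists>!p. p \<in> P \<and> u \<in> box (fst p) (snd p))"

lemma upsetD: "upset T \<Longrightarrow> u \<in> T \<Longrightarrow> (\<And>i. u i \<le> v i) \<Longrightarrow> v \<in> T"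
  by (auto simp: upset_def le_fun_def)

lemma self_in_box: "a \<in> box a Z"
  by (simp add: box_def)

text \<open>Here \<open>p\<close> labels each point with its box. Since \<open>p\<close> is constant
  on the box it assigns, two boxes with a common point have the same label.\<close>

lemma box_partitionI:
  assumes "finite (p ` T)"
    and "\<And>u. u \<in> T \<Longrightarrow> u \<in> box (fst (p u)) (snd (p u))"
    and "\<And>u v. u \<in> T \<Longrightarrow> v \<in> box (fst (p u)) (snd (p u)) \<Longrightarrow> v \<in> T \<and> p v = p u"
  shows "box_partition (p ` T) T"
  unfolding box_partition_def
proof (intro conjI ballI)
  fix q assume "q \<in> p ` T"
  then show "case q of (a, Z) \<Rightarrow> box a Z \<subseteq> T"
    unfolding split_beta using assms(3) by fast
next
  fix u assume "u \<in> T"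
  then have "p u \<in> p ` T \<and> u \<in> box (fst (p u)) (snd (p u))"
    using assms(2) by blast
  moreover have "q = p u" if "q \<in> p ` T \<and> u \<in> box (fst q) (snd q)" for q
  proof -
    obtain w where "w \<in> T" "q = p w"
      using \<open>q \<in> p ` T \<and> u \<in> box (fst q) (snd q)\<close> by blast
    then show ?thesis
      using assms(3)[of w u] that by simp
  qed
  ultimately show "\<exists>!q. q \<in> p ` T \<and> u \<in> box (fst q) (snd q)"
    by (rule ex1I)
qed (fact assms(1))

lemma finite_bounded_functions: "finite {a :: 'v::finite \<Rightarrow> nat. \<forall>i. a i \<le> N}"
proof -
  have "{a :: 'v \<Rightarrow> nat. \<forall>i. a i \<le> N} = (\<Pi>\<^sub>E i\<in>UNIV. {..N})"
    by (auto simp: PiE_UNIV_domain)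
  then show ?thesis
    by (simp add: finite_PiE)
qed

lemma finite_bounded_image:
  fixes p :: "'a \<Rightarrow> ('v::finite \<Rightarrow> nat) \<times> 'v set"
  assumes "\<And>u i. u \<in> T \<Longrightarrow> fst (p u) i \<le> N"
  shows "finite (p ` T)"
proof (rule finite_subset)
  show "p ` T \<subseteq> {a. \<forall>i. a i \<le> N} \<times> UNIV"
  proof
    fix q assume "q \<in> p ` T"
    then show "q \<in> {a. \<forall>i. a i \<le> N} \<times> UNIV"
      using assms by (auto simp: mem_Times_iff)
  qed
  show "finite ({a :: 'v \<Rightarrow> nat. \<forall>i. a i \<le> N} \<times> (UNIV :: 'v set set))"
    using finite_bounded_functions by (intro finite_cartesian_product) auto
qed

section \<open>Dickson's lemma and truncation of upsets\<close>

lemma nat_sequence_mono_subsequence: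
  fixes s :: "nat \<Rightarrow> nat"
  shows "\<exists>r :: nat \<Rightarrow> nat. strict_mono r \<and> mono (\<lambda>n. s (r n))"
proof -
  obtain r where r: "strict_mono r" "monoseq (\<lambda>n. s (r n))"
    using seq_monosub[of s] by auto
  show ?thesis
  proof (cases "mono (\<lambda>n. s (r n))")
    case False
    \<comment> \<open>The subsequence is now weakly decreasing, hence constant once it has reached
      its least value \<open>k\<close>.\<close>
    then have dec: "s (r n) \<le> s (r m)" if "m \<le> n" for m n
      using r(2) that by (auto simp: monoseq_def mono_def)
    define k where "k = (LEAST k. \<exists>n. s (r n) = k)"
    have "\<exists>n. s (r n) = k"
      unfolding k_def by (rule LeastI_ex) auto
    then obtain n0 where n0: "s (r n0) = k" ..
    have "s (r n) \<ge> k" for n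
      unfolding k_def by (rule Least_le) auto
    then have "s (r (n + n0)) = k" for n
      using dec[of n0 "n + n0"] n0 by (metis le_add2 le_antisym)
    moreover have "strict_mono (\<lambda>n. r (n + n0))"
      using r(1) by (simp add: strict_mono_def)
    ultimately show ?thesis
      by (intro exI[of _ "\<lambda>n. r (n + n0)"]) (simp add: mono_def)
  qed (use r in auto)
qed

text \<open>Subsequences are refined one coordinate at a time. With all coordinates treated, no
  sequence in the finite product of copies of the naturals is an antichain.\<close>

lemma mono_subsequence:
  fixes f :: "nat \<Rightarrow> 'v \<Rightarrow> nat"
  assumes "finite A"
  shows "\<exists>r :: nat \<Rightarrow> nat. strict_mono r \<and> (\<forall>i \<in> A. mono (\<lambda>n. f (r n) i))"
  using assms
proof induction
  case empty
  show ?case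
    by (intro exI[of _ id]) (simp add: strict_mono_def)
next
  case (insert j A)
  then obtain r :: "nat \<Rightarrow> nat" where r: "strict_mono r" "\<forall>i \<in> A. mono (\<lambda>n. f (r n) i)"
    by blast
  obtain q :: "nat \<Rightarrow> nat" where q: "strict_mono q" "mono (\<lambda>n. f (r (q n)) j)"
    using nat_sequence_mono_subsequence[of "\<lambda>n. f (r n) j"] by auto
  have "mono (\<lambda>n. f (r (q n)) i)" if "i \<in> A" for i
    using r(2) that strict_mono_mono[OF q(1)] unfolding mono_def by blast
  with q r(1) show ?case
    by (intro exI[of _ "r \<circ> q"]) (auto simp: strict_mono_def)
qed

text \<open>The minimal elements of \<open>T\<close> form an antichain, so there are finitely many
  and some \<open>N\<close> bounds their entries. A minimal element below \<open>u\<close> is then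
  also below \<open>trunc N u\<close>.\<close>

lemma upset_trunc:
  fixes T :: "('v::finite \<Rightarrow> nat) set"
  assumes "upset T"
  obtains N where "\<And>u. trunc N u \<in> T \<longleftrightarrow> u \<in> T"
proof -
  define M where "M = {u \<in> T. \<forall>v \<in> T. v \<le> u \<longrightarrow> v = u}"
  have "finite M"
  proof (rule ccontr)
    assume "infinite M"
    then obtain f :: "nat \<Rightarrow> 'v \<Rightarrow> nat" where f: "inj f" "range f \<subseteq> M"
      using infinite_countable_subset by blast
    obtain r :: "nat \<Rightarrow> nat" where r: "strict_mono r" "\<And>i. mono (\<lambda>n. f (r n) i)"
      using mono_subsequence[OF finite, of UNIV f] by blast
    have "f (r 0) \<le> f (r 1)"
      using r(2) by (auto simp: le_fun_def mono_def)
    moreover have "f (r 0) \<in> T" "f (r 1) \<in> M"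
      using f(2) unfolding M_def by blast+
    ultimately have "f (r 0) = f (r 1)"
      unfolding M_def by blast
    then have "r 0 = r 1"
      using f(1) by (simp add: inj_eq)
    then show False
      using r(1) by (metis strict_mono_eq zero_neq_one)
  qed
  \<comment> \<open>Descent on the sum of the entries.\<close>
  have below: "\<exists>m \<in> M. m \<le> u" if "u \<in> T" for u
    using that
  proof (induction "sum u UNIV" arbitrary: u rule: less_induct)
    case less
    show ?case
    proof (cases "u \<in> M")
      case False
      then obtain v where v: "v \<in> T" "v \<le> u" "v \<noteq> u"
        using less.prems by (auto simp: M_def)
      then obtain i where "v i < u i"
        by (metis ext le_funD nless_le)
      then have "sum v UNIV < sum u UNIV"
        using v(2) by (intro sum_strict_mono_ex1) (auto simp: le_fun_def)
      then show ?thesis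
        using less.hyps v by (meson order_trans)
    qed auto
  qed
  have "finite ((\<lambda>(m, i). m i) ` (M \<times> (UNIV :: 'v set)))"
    using \<open>finite M\<close> by simp
  then obtain N where "\<And>k. k \<in> (\<lambda>(m, i). m i) ` (M \<times> UNIV) \<Longrightarrow> k \<le> N"
    unfolding finite_nat_set_iff_bounded_le by blast
  then have N: "m i \<le> N" if "m \<in> M" for m i
    using that by force
  have "trunc N u \<in> T" if u: "u \<in> T" for u
  proof -
    obtain m where "m \<in> M" "m \<le> u"
      using below u by blast
    then have "m \<in> T" "m i \<le> trunc N u i" for i
      using N by (auto simp: M_def trunc_def le_fun_def)
    then show ?thesis
      by (rule upsetD[OF assms])
  qed
  moreover have "u \<in> T" if "trunc N u \<in> T" for u
    using that assms upsetD[of T "trunc N u" u] by (auto simp: trunc_def)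
  ultimately show ?thesis
    using that by blast
qed

section \<open>Box partitions of prescribed dimension\<close>

text \<open>The fibres of \<open>trunc N\<close> are boxes: entries below \<open>N\<close> are
  fixed, the others run freely from \<open>N\<close> on. Since \<open>T\<close> is only required to
  be a union of fibres, this applies to complements of upsets too.\<close>

lemma box_partition_exists:
  fixes T :: "('v::finite \<Rightarrow> nat) set"
  assumes "\<And>u. trunc N u \<in> T \<longleftrightarrow> u \<in> T"
  shows "\<exists>P. box_partition P T"
proof -
  define p where "p u = (trunc N u, {i. N \<le> u i})" for u :: "'v \<Rightarrow> nat"
  have "box_partition (p ` T) T"
  proof (rule box_partitionI)
    show "finite (p ` T)"
      by (rule finite_bounded_image[of _ _ N]) (auto simp: p_def trunc_def)
  next
    fix u v assume uv: "u \<in> T" "v \<in> box (fst (p u)) (snd (p u))"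
    have "min (v i) N = min (u i) N" "N \<le> v i \<longleftrightarrow> N \<le> u i" for i
      using uv(2) by (auto simp: p_def box_def trunc_def dest!: spec[of _ i])
    then have "trunc N v = trunc N u" "p v = p u"
      by (auto simp: p_def trunc_def)
    with uv(1) show "v \<in> T \<and> p v = p u"
      using assms by metis
  qed (auto simp: p_def box_def trunc_def)
  then show ?thesis ..
qed

text \<open>
  Over each point of the coordinate hyperplane \<open>z = 0\<close>, \<open>T\<close> is a half-line in direction \<open>z\<close>
  whose starting height depends only on the truncation of the point.
\<close>

lemma upset_box_partition_pos:
  fixes T :: "('v::finite \<Rightarrow> nat) set"
  assumes "upset T"
  shows "\<exists>P. box_partition P T \<and> (\<forall>(a, Z) \<in> P. card Z \<ge> 1)"
proof -
  obtain N where N: "\<And>u. trunc N u \<in> T \<longleftrightarrow> u \<in> T"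
    using upset_trunc[OF assms] by blast
  fix z :: 'v
  define h where "h u = (LEAST k. u(z := k) \<in> T)" for u
  \<comment> \<open>Off the axis \<open>z\<close> the boxes are fibres of truncation; along
    \<open>z\<close> they start at the common height of the fibre.\<close>
  define p where "p u = ((trunc N u)(z := h u), insert z {i. N \<le> u i})" for u
  have h_in: "u(z := h u) \<in> T" if "u \<in> T" for u
    unfolding h_def by (rule LeastI[of _ "u z"]) (use that in simp)
  have h_le: "h u \<le> N" if "u \<in> T" for u
  proof -
    have "trunc N u \<in> T"
      using that N by blast
    then have "u(z := N) \<in> T"
      by (rule upsetD[OF assms]) (auto simp: trunc_def)
    then show ?thesis
      unfolding h_def by (rule Least_le)
  qed
  have "box_partition (p ` T) T"
  proof (rule box_partitionI)
    show "finite (p ` T)"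
      using h_le by (intro finite_bounded_image[of _ _ N]) (auto simp: p_def trunc_def)
  next
    fix u assume u: "u \<in> T"
    then have "h u \<le> u z"
      unfolding h_def by (intro Least_le) simp
    then show "u \<in> box (fst (p u)) (snd (p u))"
      by (auto simp: p_def box_def trunc_def)
  next
    fix u v assume uv: "u \<in> T" "v \<in> box (fst (p u)) (snd (p u))"
    have eq: "min (v i) N = min (u i) N" "N \<le> v i \<longleftrightarrow> N \<le> u i" if "i \<noteq> z" for i
      using uv(2) that by (auto simp: p_def box_def trunc_def dest!: spec[of _ i])
    have "trunc N (v(z := k)) = trunc N (u(z := k))" for k
      using eq by (auto simp: trunc_def)
    then have T_eq: "v(z := k) \<in> T \<longleftrightarrow> u(z := k) \<in> T" for k
      using N by metis
    then have h_eq: "h v = h u"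
      by (simp add: h_def)
    have "h u \<le> v z"
      using uv(2) by (auto simp: p_def box_def dest!: spec[of _ z])
    then have "v \<in> T"
      using upsetD[OF assms, of "v(z := h u)" v] T_eq h_in uv(1) by auto
    moreover have "(trunc N v)(z := h u) = (trunc N u)(z := h u)"
      using eq by (auto simp: trunc_def)
    moreover have "insert z {i. N \<le> v i} = insert z {i. N \<le> u i}"
      using eq(2) by blast
    ultimately show "v \<in> T \<and> p v = p u"
      using h_eq by (simp add: p_def)
  qed
  moreover have "card (snd (p u)) \<ge> 1" for u
    by (simp add: p_def Suc_le_eq card_gt_0_iff)
  ultimately show ?thesis
    by (intro exI[of _ "p ` T"]) (auto simp: split_beta)
qed

text \<open>
  A point of a level set of \<open>H\<close> starts an infinite lattice path inside the level set; since
  \<open>H\<close> is antitone, such a path cannot avoid both the row and the column of its first point.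
\<close>

lemma antitone_level_row_or_column:
  fixes H :: "nat \<Rightarrow> nat \<Rightarrow> nat"
  assumes anti: "\<And>i j i' j'. i \<le> i' \<Longrightarrow> j \<le> j' \<Longrightarrow> H i' j' \<le> H i j"
    and step: "\<And>i j. H i j = k \<Longrightarrow> H (Suc i) j = k \<or> H i (Suc j) = k"
    and "H i j = k" "i \<le> i'" "j \<le> j'"
  shows "H i' j = k \<or> H i j' = k"
  using assms(3-)
proof (induction "(i' - i) + (j' - j)" arbitrary: i j rule: less_induct)
  case less
  show ?case
  proof (cases "i = i' \<or> j = j'")
    case False
    then have lt: "i < i'" "j < j'"
      using less.prems by auto
    consider "H (Suc i) j = k" | "H i (Suc j) = k"
      using step less.prems(1) by blast
    then show ?thesis
    proof cases
      case 1
      then have "H i' j = k \<or> H (Suc i) j' = k"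
        using lt by (intro less.hyps) auto
      \<comment> \<open>If the column of the shifted point stays at level \<open>k\<close>, then
        \<open>H i j'\<close> is squeezed between two values equal to \<open>k\<close>. The other
        case is symmetric.\<close>
      moreover have "H (Suc i) j' \<le> H i j'" "H i j' \<le> H i j"
        using lt by (auto intro: anti)
      ultimately show ?thesis
        using less.prems(1) by force
    next
      case 2
      then have "H i' (Suc j) = k \<or> H i j' = k"
        using lt by (intro less.hyps) auto
      moreover have "H i' (Suc j) \<le> H i' j" "H i' j \<le> H i j"
        using lt by (auto intro: anti)
      ultimately show ?thesis
        using less.prems(1) by force
    qed
  qed (use less.prems in auto)
qed

text \<open>
  Let \<open>H i j\<close> be the height at which \<open>T\<close> starts over the point \<open>(i, j)\<close>. A row or a column of
  a level set of \<open>H\<close> is extended in direction \<open>z\<close> to a two-dimensional box; the rows beyond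
  \<open>N\<close> agree and are merged into three-dimensional boxes.
\<close>

lemma saturated_upset_box_partition:
  fixes T :: "('v::finite \<Rightarrow> nat) set"
  assumes "upset T" and card3: "card (UNIV :: 'v set) = 3"
    and saturated: "\<And>u. u \<notin> T \<Longrightarrow> \<exists>i. u(i := Suc (u i)) \<notin> T"
  shows "\<exists>P. box_partition P T \<and> (\<forall>(a, Z) \<in> P. card Z \<ge> 2)"
proof -
  obtain N where N: "\<And>u. trunc N u \<in> T \<longleftrightarrow> u \<in> T"
    using upset_trunc[OF assms(1)] by blast
  obtain x y z :: 'v where xyz: "UNIV = {x, y, z}" "x \<noteq> y" "y \<noteq> z" "x \<noteq> z"
    using card3 unfolding card_3_iff by metis
  have all_xyz: "(\<forall>c. Q c) \<longleftrightarrow> Q x \<and> Q y \<and> Q z" for Q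
    using xyz(1) by (metis UNIV_I empty_iff insert_iff)
  define pt where "pt i j k = (\<lambda>c. if c = x then i else if c = y then j else k)" for i j k :: nat
  have pt [simp]: "pt i j k x = i" "pt i j k y = j" "pt i j k z = k" for i j k
    using xyz by (auto simp: pt_def)
  have pt_eqI: "u = pt i j k" if "u x = i" "u y = j" "u z = k" for u i j k
    using that all_xyz[of "\<lambda>c. u c = pt i j k c"] by auto
  have pt_self: "pt (u x) (u y) (u z) = u" for u
    by (rule pt_eqI[symmetric]) auto
  have pt_trunc: "pt (min i N) (min j N) (min k N) \<in> T \<longleftrightarrow> pt i j k \<in> T" for i j k
  proof -
    have "trunc N (pt i j k) = pt (min i N) (min j N) (min k N)"
      by (rule pt_eqI) (auto simp: trunc_def)
    then show ?thesis
      using N by metis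
  qed
  have pt_mono: "pt i' j' k' \<in> T" if "pt i j k \<in> T" "i \<le> i'" "j \<le> j'" "k \<le> k'" for i j k i' j' k'
    using that(1) by (rule upsetD[OF assms(1)]) (use that in \<open>auto simp: pt_def\<close>)
  \<comment> \<open>The value \<open>Suc N\<close> marks an empty line over \<open>(i, j)\<close>;
    it also makes \<open>LEAST\<close> well defined. By truncation, a nonempty line starts at height
    at most \<open>N\<close>.\<close>
  define H where "H i j = (LEAST k. pt i j k \<in> T \<or> k = Suc N)" for i j
  have H_in: "pt i j (H i j) \<in> T \<or> H i j = Suc N" for i j
    unfolding H_def by (rule LeastI) auto
  have H_le: "H i j \<le> k" if "pt i j k \<in> T" for i j k
    unfolding H_def using that by (intro Least_le) auto
  have H_le_Suc: "H i j \<le> Suc N" for i j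
    unfolding H_def by (intro Least_le) auto
  have T_iff: "u \<in> T \<longleftrightarrow> H (u x) (u y) \<le> N \<and> H (u x) (u y) \<le> u z" for u
  proof
    assume u: "u \<in> T"
    then have "pt (u x) (u y) (min (u z) N) \<in> T"
      using pt_trunc[of "u x" "u y" "min (u z) N"] pt_trunc[of "u x" "u y" "u z"]
      by (simp add: pt_self)
    then show "H (u x) (u y) \<le> N \<and> H (u x) (u y) \<le> u z"
      using H_le by fastforce
  next
    assume "H (u x) (u y) \<le> N \<and> H (u x) (u y) \<le> u z"
    then show "u \<in> T"
      using H_in[of "u x" "u y"] pt_mono[of "u x" "u y" "H (u x) (u y)" "u x" "u y" "u z"]
      by (auto simp: pt_self)
  qed
  have H_anti: "H i' j' \<le> H i j" if "i \<le> i'" "j \<le> j'" for i j i' j'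
    using H_in[of i j] H_le_Suc[of i' j'] H_le[of i' j'] pt_mono[OF _ that] by force
  have "pt (min i N) (min j N) k \<in> T \<longleftrightarrow> pt i j k \<in> T" for i j k
    using pt_trunc[of i j k] pt_trunc[of "min i N" "min j N" k] by simp
  then have H_min: "H (min i N) (min j N) = H i j" for i j
    by (simp add: H_def)
  have H_min1: "H (min i N) j = H i j" and H_min2: "H i (min j N) = H i j" for i j
    using H_min[of i j] H_min[of "min i N" j] H_min[of i "min j N"] by simp_all
  \<comment> \<open>The point just below the start of a line is outside \<open>T\<close>, so
    saturation moves it in some direction without entering \<open>T\<close>. Direction
    \<open>z\<close> would enter \<open>T\<close>, so a neighbouring line starts no earlier, and by
    antitonicity at the same height.\<close>
  have H_step: "H (Suc i) j = k \<or> H i (Suc j) = k" if "H i j = k" "k \<le> N" for i j k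
  proof (cases k)
    case 0
    then show ?thesis
      using H_anti[of i "Suc i" j j] that by auto
  next
    case (Suc l)
    have "pt i j l \<notin> T"
      using H_le[of i j l] that Suc by auto
    then obtain c where c: "(pt i j l)(c := Suc (pt i j l c)) \<notin> T"
      using saturated by blast
    have "c = x \<or> c = y \<or> c = z"
      using xyz(1) by auto
    moreover have "c \<noteq> z"
    proof
      assume "c = z"
      then have "(pt i j l)(c := Suc (pt i j l c)) = pt i j k"
        using xyz Suc by (intro pt_eqI) auto
      then show False
        using c that H_in[of i j] by auto
    qed
    moreover have "H (Suc i) j = k" if "c = x"
    proof -
      have "(pt i j l)(c := Suc (pt i j l c)) = pt (Suc i) j l"
        using xyz that by (intro pt_eqI) auto
      then have "\<not> (H (Suc i) j \<le> N \<and> H (Suc i) j \<le> l)"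
        using c T_iff[of "pt (Suc i) j l"] by auto
      then show ?thesis
        using H_anti[of i "Suc i" j j] \<open>H i j = k\<close> \<open>k \<le> N\<close> Suc by auto
    qed
    moreover have "H i (Suc j) = k" if "c = y"
    proof -
      have "(pt i j l)(c := Suc (pt i j l c)) = pt i (Suc j) l"
        using xyz that by (intro pt_eqI) auto
      then have "\<not> (H i (Suc j) \<le> N \<and> H i (Suc j) \<le> l)"
        using c T_iff[of "pt i (Suc j) l"] by auto
      then show ?thesis
        using H_anti[of i i j "Suc j"] \<open>H i j = k\<close> \<open>k \<le> N\<close> Suc by auto
    qed
    ultimately show ?thesis
      by blast
  qed
  \<comment> \<open>The row from \<open>(i, j)\<close> leaves the level by the time it reaches
    \<open>max i N\<close>, where \<open>H\<close> equals \<open>H N j\<close>. The alternative of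
    row or column then leaves only the column.\<close>
  have column: "H i j' = H i j"
    if "H i j \<le> N" "H N j \<noteq> H i j" "j \<le> j'" for i j j'
  proof -
    have "H (max i N) j \<noteq> H i j"
      using that(2) H_min1[of "max i N" j] by (simp add: min_def max_def split: if_splits)
    then show ?thesis
      using antitone_level_row_or_column[of H "H i j" i j "max i N" j'] H_anti H_step that by auto
  qed
  have H_N_le: "H N j \<le> H i j" for i j
    using H_anti[of "min i N" N j j] H_min1[of i j] by simp
  have row: "H i' j = H i j" if "H N j = H i j" "i \<le> i'" for i i' j
    using H_anti[of i i' j j] H_N_le[of j i'] that by simp
  \<comment> \<open>\<open>r\<close> is the first point of a row at level \<open>k\<close>.
    \<open>s\<close> is the first point of a column at level \<open>k\<close> among those whose row
    eventually leaves the level.\<close>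
  define r where "r j k = (LEAST i. H i j = k)" for j k
  define s where "s i k = (LEAST j. H i j = k \<and> H N j \<noteq> k)" for i k
  \<comment> \<open>\<open>H N (u y)\<close> is the eventual value of the row through
    \<open>u\<close>. If it is the level of \<open>u\<close>, the rest of the row stays at this
    level and gives a box in directions \<open>x\<close> and \<open>z\<close>; otherwise a column
    box is used. Truncating \<open>u y\<close> gives all rows from \<open>N\<close> on the same
    label.\<close>
  define p where "p u =
     (if H N (u y) = H (u x) (u y)
      then (pt (r (min (u y) N) (H (u x) (u y))) (min (u y) N) (H (u x) (u y)),
            {x, z} \<union> {c. c = y \<and> N \<le> u y})
      else (pt (u x) (s (u x) (H (u x) (u y))) (H (u x) (u y)), {y, z}))" for u
  have r_le: "r (min j N) k \<le> i" and H_r: "H (r (min j N) k) j = k" if "H i j = k" for i j k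
    using that Least_le[of "\<lambda>i. H i (min j N) = k" i] LeastI[of "\<lambda>i. H i (min j N) = k" i]
    by (auto simp: r_def H_min2)
  have s_le: "s i k \<le> j" and H_s: "H i (s i k) = k" "H N (s i k) \<noteq> k"
    if "H i j = k" "H N j \<noteq> k" for i j k
    using that Least_le[of "\<lambda>j. H i j = k \<and> H N j \<noteq> k" j] LeastI[of "\<lambda>j. H i j = k \<and> H N j \<noteq> k" j]
    by (auto simp: s_def)
  have "box_partition (p ` T) T"
  proof (rule box_partitionI)
    have "fst (p u) c \<le> N" if u: "u \<in> T" for u c
    proof -
      have "H (u x) (u y) \<le> N"
        using u T_iff by blast
      moreover have "r (min (u y) N) (H (u x) (u y)) \<le> N" if "H N (u y) = H (u x) (u y)"
        using r_le that by blast
      \<comment> \<open>Beyond \<open>N\<close> a row has reached its eventual value, so column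
        boxes only start at \<open>x\<close>-coordinates up to \<open>N\<close>.\<close>
      moreover have "u x \<le> N" if "H N (u y) \<noteq> H (u x) (u y)"
        using that H_min1[of "u x" "u y"] by (cases "u x \<le> N") auto
      moreover have "s (u x) (H (u x) (u y)) \<le> N" if "H N (u y) \<noteq> H (u x) (u y)"
        using s_le[of "u x" "min (u y) N" "H (u x) (u y)"] that by (auto simp: H_min2)
      ultimately show ?thesis
        by (auto simp: p_def pt_def)
    qed
    then show "finite (p ` T)"
      by (rule finite_bounded_image)
  next
    fix u assume "u \<in> T"
    then have "H (u x) (u y) \<le> u z"
      using T_iff by blast
    then show "u \<in> box (fst (p u)) (snd (p u))"
      using xyz r_le s_le by (auto simp: p_def box_def all_xyz)
  next
    fix u v assume uv: "u \<in> T" "v \<in> box (fst (p u)) (snd (p u))"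
    define k where "k = H (u x) (u y)"
    have k: "k \<le> N"
      using uv(1) T_iff k_def by blast
    show "v \<in> T \<and> p v = p u"
    proof (cases "H N (u y) = k")
      case True
      have v: "r (min (u y) N) k \<le> v x" "min (v y) N = min (u y) N" "N \<le> v y \<longleftrightarrow> N \<le> u y" "k \<le> v z"
        using uv(2) True xyz by (auto simp: p_def box_def all_xyz k_def[symmetric] split: if_splits)
      have H_eq: "H i (v y) = H i (u y)" for i
        using v(2) H_min2 by metis
      have "H (r (min (u y) N) k) (u y) = k"
        using H_r[of N] True by blast
      then have "H (v x) (u y) = k"
        using row[OF _ v(1)] True by simp
      then show ?thesis
        using v k T_iff[of v] H_eq True by (simp add: p_def k_def[symmetric])
    next
      case False
      have v: "v x = u x" "s (u x) k \<le> v y" "k \<le> v z"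
        using uv(2) False xyz by (auto simp: p_def box_def all_xyz k_def[symmetric])
      note s = H_s[of "u x" "u y", OF k_def[symmetric] False]
      have "H (u x) (v y) = k"
        using column[OF _ _ v(2)] s k by auto
      \<comment> \<open>The eventual row value is already below \<open>k\<close> at the start of the
        column and can only decrease further, so no later point of the column switches to a row
        box.\<close>
      moreover have "H N (v y) \<noteq> k"
      proof -
        have "H N (s (u x) k) \<le> k"
          using H_N_le[of "s (u x) k" "u x"] s(1) by simp
        then show ?thesis
          using s(2) H_anti[of N N "s (u x) k" "v y"] v(2) by simp
      qed
      ultimately show ?thesis
        using v k T_iff[of v] False by (simp add: p_def k_def[symmetric])
    qed
  qed
  moreover have "card (snd (p u)) \<ge> 2" for u
  proof -
    have "{x, z} \<subseteq> snd (p u) \<or> {y, z} \<subseteq> snd (p u)"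
      by (auto simp: p_def)
    then show ?thesis
      using xyz card_mono[of "snd (p u)" "{x, z}"] card_mono[of "snd (p u)" "{y, z}"] by auto
  qed
  ultimately show ?thesis
    by (intro exI[of _ "p ` T"]) (auto simp: split_beta)
qed

section \<open>Recognizing principal ideals\<close>

text \<open>The coordinatewise minimum \<open>a\<close> is the exponent of the gcd of the monomials
  in \<open>T\<close>. Were \<open>a\<close> outside \<open>T\<close>, a box at \<open>a\<close>
  lacking at most one direction would miss \<open>T\<close>; but a point of \<open>T\<close>
  attaining the minimum in that direction lies in this box.\<close>

lemma upset_eq_box_UNIV:
  fixes T :: "('v::finite \<Rightarrow> nat) set"
  assumes "upset T" "T \<noteq> {}"
    and codim: "\<And>u. u \<notin> T \<Longrightarrow> \<exists>Z. card (UNIV :: 'v set) \<le> card Z + 1 \<and> box u Z \<inter> T = {}"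
  obtains a where "T = box a UNIV"
proof -
  define a where "a i = (LEAST k. \<exists>u \<in> T. u i = k)" for i
  have a_le: "a i \<le> u i" if "u \<in> T" for u i
    unfolding a_def using that by (intro Least_le) auto
  have a_attained: "\<exists>u \<in> T. u i = a i" for i
    unfolding a_def by (rule LeastI_ex) (use assms(2) in auto)
  have "a \<in> T"
  proof (rule ccontr)
    assume "a \<notin> T"
    then obtain Z where Z: "card (UNIV :: 'v set) \<le> card Z + 1" "box a Z \<inter> T = {}"
      using codim by blast
    have "card (- Z) \<le> 1"
      using Z(1) by (simp add: card_Diff_subset Compl_eq_Diff_UNIV)
    \<comment> \<open>If \<open>Z\<close> is everything, any \<open>i\<close> serves.\<close>
    then obtain i where i: "- Z \<subseteq> {i}"
      by (metis card_le_Suc0_iff_eq finite empty_subsetI subset_singleton_iff One_nat_def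
          ex_in_conv insert_iff subsetI)
    obtain u where "u \<in> T" "u i = a i"
      using a_attained by blast
    moreover from this have "u \<in> box a Z"
      using a_le i by (auto simp: box_def)
    ultimately show False
      using Z(2) by blast
  qed
  then have "u \<in> T" if "u \<in> box a UNIV" for u
    by (rule upsetD[OF assms(1)]) (use that in \<open>simp add: box_def\<close>)
  moreover have "u \<in> box a UNIV" if "u \<in> T" for u
    using a_le[OF that] by (simp add: box_def)
  ultimately have "T = box a UNIV"
    by blast
  then show ?thesis
    using that by blast
qed

lemma box_partition_singleton: "box_partition {(a, Z)} (box a Z)"
  by (auto simp: box_partition_def)

section \<open>Polynomials with prescribed support\<close>

definition supported :: "('v \<Rightarrow> nat) set \<Rightarrow> ('v, 'k::comm_ring_1) mpoly set" where
  "supported T = {f. \<forall>b \<in> Poly_Mapping.keys f. Poly_Mapping.lookup b \<in> T}"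

definition restr :: "('v \<Rightarrow> nat) set \<Rightarrow> ('v, 'k::comm_ring_1) mpoly \<Rightarrow> ('v, 'k) mpoly" where
  "restr B f = Abs_poly_mapping
     (\<lambda>b. if Poly_Mapping.lookup b \<in> B then Poly_Mapping.lookup f b else 0)"

text \<open>Exponents become plain functions, on which the pointwise order and updates act directly.
  For finitely many variables every such function is the \<open>lookup\<close> of an exponent
  vector.\<close>

definition exps :: "('v, 'k::comm_ring_1) mpoly set \<Rightarrow> ('v \<Rightarrow> nat) set" where
  "exps I = Poly_Mapping.lookup ` {b. monomial b \<in> I}"

lemma exps_iff [simp]: "Poly_Mapping.lookup b \<in> exps I \<longleftrightarrow> monomial b \<in> I"
  unfolding exps_def by (auto simp: poly_mapping_eq_iff[symmetric])

lemma lookup_Abs_finite [simp]: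
  fixes u :: "'v::finite \<Rightarrow> nat"
  shows "Poly_Mapping.lookup (Abs_poly_mapping u) = u"
  by (rule lookup_Abs_poly_mapping) simp

lemma supported_iff:
  "f \<in> supported T \<longleftrightarrow> (\<forall>b. Poly_Mapping.lookup f b \<noteq> 0 \<longrightarrow> Poly_Mapping.lookup b \<in> T)"
  by (auto simp: supported_def in_keys_iff)

lemma supported_zero [simp]: "0 \<in> supported T"
  by (simp add: supported_def)

lemma supported_add: "f \<in> supported T \<Longrightarrow> g \<in> supported T \<Longrightarrow> f + g \<in> supported T"
  using keys_add[of f g] by (auto simp: supported_def)

lemma supported_diff: "f \<in> supported T \<Longrightarrow> g \<in> supported T \<Longrightarrow> f - g \<in> supported T"
  by (auto simp: supported_iff lookup_minus) (metis diff_self)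

lemma supported_empty: "supported {} = {0}"
  by (auto simp: supported_def)

lemma supported_UNIV: "supported UNIV = UNIV"
  by (auto simp: supported_def)

lemma supported_mono: "f \<in> supported T \<Longrightarrow> T \<subseteq> T' \<Longrightarrow> f \<in> supported T'"
  by (auto simp: supported_def)

lemma supported_sum: "(\<And>i. i \<in> A \<Longrightarrow> f i \<in> supported T) \<Longrightarrow> sum f A \<in> supported T"
  by (induction A rule: infinite_finite_induct) (auto intro: supported_add)

lemma supported_Int_Compl: "f \<in> supported T \<Longrightarrow> f \<in> supported (- T) \<Longrightarrow> f = 0"
  by (intro poly_mapping_eqI) (auto simp: supported_iff)

lemma monomial_in_supported: "Poly_Mapping.lookup a \<in> T \<Longrightarrow> monomial a \<in> supported T"
  by (auto simp: supported_def monomial_def)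

lemma lookup_restr:
  "Poly_Mapping.lookup (restr B f) b = (if Poly_Mapping.lookup b \<in> B then Poly_Mapping.lookup f b else 0)"
proof -
  have "finite {b. (if Poly_Mapping.lookup b \<in> B then Poly_Mapping.lookup f b else 0) \<noteq> 0}"
    by (rule finite_subset[OF _ finite_lookup[of f]]) auto
  then show ?thesis
    by (simp add: restr_def)
qed

lemma restr_supported: "restr B f \<in> supported B"
  by (simp add: supported_iff lookup_restr)

lemma lookup_times_monomial:
  fixes f :: "('v, 'k::comm_ring_1) mpoly"
  shows "Poly_Mapping.lookup (f * monomial a) (c + a) = Poly_Mapping.lookup f c"
proof -
  have "(\<Sum>q. Poly_Mapping.lookup (monomial a :: ('v, 'k) mpoly) q when c + a = l + q) =
      (1 when l = c)" for l
  proof -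
    have "(\<Sum>q. Poly_Mapping.lookup (monomial a :: ('v, 'k) mpoly) q when c + a = l + q) =
        (\<Sum>q. ((1 when c + a = l + q) when q = a))"
      by (intro Sum_any.cong) (auto simp: monomial_def lookup_single when_def)
    then show ?thesis
      by (simp add: when_def)
  qed
  then show ?thesis
    by (simp add: lookup_mult mult_when)
qed

lemma keys_times_monomial:
  "Poly_Mapping.keys (f * monomial a) = (\<lambda>c. c + a) ` Poly_Mapping.keys f"
proof
  show "Poly_Mapping.keys (f * monomial a) \<subseteq> (\<lambda>c. c + a) ` Poly_Mapping.keys f"
    using keys_mult[of f "monomial a"] by (auto simp: monomial_def split: if_splits)
  show "(\<lambda>c. c + a) ` Poly_Mapping.keys f \<subseteq> Poly_Mapping.keys (f * monomial a)"
    by (auto simp: in_keys_iff lookup_times_monomial)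
qed

lemma times_monomial_inject: "f * monomial a = g * monomial a \<Longrightarrow> f = g"
  by (metis lookup_times_monomial poly_mapping_eqI)

lemma lookup_in_box_iff:
  "Poly_Mapping.lookup b \<in> box (Poly_Mapping.lookup a) Z \<longleftrightarrow>
     (\<exists>c. b = c + a \<and> Poly_Mapping.keys c \<subseteq> Z)"
proof
  assume b: "Poly_Mapping.lookup b \<in> box (Poly_Mapping.lookup a) Z"
  have "b = (b - a) + a"
    using b by (intro poly_mapping_eqI) (simp add: box_def lookup_add lookup_minus)
  moreover have "Poly_Mapping.keys (b - a) \<subseteq> Z"
    using b by (fastforce simp: box_def in_keys_iff lookup_minus)
  ultimately show "\<exists>c. b = c + a \<and> Poly_Mapping.keys c \<subseteq> Z"
    by blast
qed (auto simp: box_def lookup_add in_keys_iff)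

text \<open>This turns x^a K[Z] into a condition on supports, so that Stanley spaces can be handled
  through boxes.\<close>

lemma subpoly_times_monomial:
  fixes a :: "'v \<Rightarrow>\<^sub>0 nat"
  shows "(\<lambda>f. f * monomial a) ` subpoly Z =
    (supported (box (Poly_Mapping.lookup a) Z) :: ('v, 'k::comm_ring_1) mpoly set)"
proof
  show "(\<lambda>f. f * monomial a) ` subpoly Z \<subseteq>
      (supported (box (Poly_Mapping.lookup a) Z) :: ('v, 'k) mpoly set)"
    by (auto simp: supported_def keys_times_monomial subpoly_def lookup_in_box_iff)
next
  show "(supported (box (Poly_Mapping.lookup a) Z) :: ('v, 'k) mpoly set) \<subseteq>
      (\<lambda>f. f * monomial a) ` subpoly Z"
  proof
    fix g :: "('v, 'k) mpoly" assume g: "g \<in> supported (box (Poly_Mapping.lookup a) Z)"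
    \<comment> \<open>The quotient of \<open>g\<close> by x^a; the shift of exponents is injective,
      so the support stays finite.\<close>
    define f where "f = Abs_poly_mapping (\<lambda>c. Poly_Mapping.lookup g (c + a))"
    have "finite ((\<lambda>c. c + a) -` {b. Poly_Mapping.lookup g b \<noteq> 0})"
      by (intro finite_vimageI) (auto simp: inj_on_def)
    then have f: "Poly_Mapping.lookup f c = Poly_Mapping.lookup g (c + a)" for c
      by (simp add: f_def vimage_def)
    have keys_g: "\<exists>c. b = c + a \<and> Poly_Mapping.keys c \<subseteq> Z" if "b \<in> Poly_Mapping.keys g" for b
      using g that by (auto simp: supported_def lookup_in_box_iff)
    have "g = f * monomial a"
    proof (rule poly_mapping_eqI)
      fix b
      show "Poly_Mapping.lookup g b = Poly_Mapping.lookup (f * monomial a) b"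
      proof (cases "\<exists>c. b = c + a")
        case True
        then show ?thesis
          by (auto simp: lookup_times_monomial f)
      next
        case False
        then have "b \<notin> Poly_Mapping.keys g" "b \<notin> Poly_Mapping.keys (f * monomial a)"
          using keys_g by (auto simp: keys_times_monomial)
        then show ?thesis
          by (simp add: in_keys_iff)
      qed
    qed
    moreover have "f \<in> subpoly Z"
    proof -
      have "Poly_Mapping.keys c \<subseteq> Z" if "c \<in> Poly_Mapping.keys f" for c
        using keys_g[of "c + a"] that by (auto simp: in_keys_iff f)
      then show ?thesis
        by (simp add: subpoly_def)
    qed
    ultimately show "g \<in> (\<lambda>f. f * monomial a) ` subpoly Z"
      by blast
  qed
qed

lemma lookup_eq_zero_of_monomial_notin:
  assumes I: "I = supported (exps I)" and f: "f \<in> I" and b: "monomial b \<notin> I"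
  shows "Poly_Mapping.lookup f b = 0"
proof -
  have "f \<in> supported (exps I)"
    using f I by blast
  then show ?thesis
    using b exps_iff[of b I] unfolding supported_iff by blast
qed

lemma zero_in_subpoly: "0 \<in> subpoly Z"
  by (simp add: subpoly_def)

lemma subpoly_mult: "f \<in> subpoly Z \<Longrightarrow> g \<in> subpoly Z \<Longrightarrow> f * g \<in> subpoly Z"
  using keys_mult[of f g] unfolding subpoly_def by (fastforce dest!: subsetD[OF keys_add])

section \<open>Monomial ideals\<close>

lemma poly_ring_simps [simp]:
  "carrier poly_ring = UNIV" "mult poly_ring = (*)" "one poly_ring = 1"
  "zero poly_ring = 0" "add poly_ring = (+)"
  by (simp_all add: poly_ring_def)

lemma cring_poly_ring: "cring (poly_ring :: ('v, 'k::comm_ring_1) mpoly ring)"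
proof (rule cringI)
  show "abelian_group (poly_ring :: ('v, 'k) mpoly ring)"
  proof (rule abelian_groupI)
    fix f :: "('v, 'k) mpoly"
    show "\<exists>g \<in> carrier poly_ring. g \<oplus>\<^bsub>poly_ring\<^esub> f = \<zero>\<^bsub>poly_ring\<^esub>"
      by (intro bexI[of _ "- f"]) auto
  qed (auto simp: algebra_simps)
  show "Group.comm_monoid (poly_ring :: ('v, 'k) mpoly ring)"
    by (rule comm_monoidI) (auto simp: algebra_simps)
qed (auto simp: algebra_simps)

lemmas ring_poly_ring = cring.axioms(1)[OF cring_poly_ring]

lemma ideal_poly_ringI:
  assumes "0 \<in> I" "\<And>f g. f \<in> I \<Longrightarrow> g \<in> I \<Longrightarrow> f + g \<in> I" "\<And>f h. f \<in> I \<Longrightarrow> h * f \<in> I"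
  shows "ideal I poly_ring"
proof (rule idealI)
  interpret cring "poly_ring :: ('a, 'b) mpoly ring"
    by (rule cring_poly_ring)
  show "subgroup I (add_monoid poly_ring)"
  proof (rule add.subgroupI)
    fix f assume "f \<in> I"
    moreover have "\<ominus>\<^bsub>poly_ring\<^esub> f = - f"
      by (rule minus_equality) auto
    ultimately show "\<ominus>\<^bsub>poly_ring\<^esub> f \<in> I"
      using assms(3)[of f "-1"] by simp
  qed (use assms in auto)
qed (use assms ring_poly_ring in \<open>auto simp: mult.commute\<close>)

lemma ideal_poly_ringD:
  assumes "ideal I poly_ring"
  shows "0 \<in> I" "\<And>f g. f \<in> I \<Longrightarrow> g \<in> I \<Longrightarrow> f + g \<in> I" "\<And>f h. f \<in> I \<Longrightarrow> h * f \<in> I"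
    "\<And>f h. f \<in> I \<Longrightarrow> f * h \<in> I" "\<And>f. f \<in> I \<Longrightarrow> - f \<in> I" "\<And>f g. f \<in> I \<Longrightarrow> g \<in> I \<Longrightarrow> f - g \<in> I"
proof -
  interpret ideal I poly_ring
    by fact
  show 0: "0 \<in> I" and add: "\<And>f g. f \<in> I \<Longrightarrow> g \<in> I \<Longrightarrow> f + g \<in> I"
    and mult: "\<And>f h. f \<in> I \<Longrightarrow> h * f \<in> I" "\<And>f h. f \<in> I \<Longrightarrow> f * h \<in> I"
    using additive_subgroup.zero_closed[OF is_additive_subgroup]
      additive_subgroup.a_closed[OF is_additive_subgroup] I_l_closed I_r_closed
    by simp_all
  show minus: "- f \<in> I" if "f \<in> I" for f
    using mult(1)[OF that, of "-1"] by simp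
  show "f - g \<in> I" if "f \<in> I" "g \<in> I" for f g
    using add[OF that(1) minus[OF that(2)]] by simp
qed

lemma monomial_mult: "monomial a * monomial b = monomial (a + b)"
  by (simp add: monomial_def mult_single)

lemma upset_exps:
  fixes I :: "('v::finite, 'k::comm_ring_1) mpoly set"
  assumes "ideal I poly_ring"
  shows "upset (exps I)"
  unfolding upset_def
proof (intro ballI allI impI)
  fix u v assume "u \<in> exps I" "u \<le> v"
  then obtain b where b: "u = Poly_Mapping.lookup b" "monomial b \<in> I"
    by (auto simp: exps_def)
  have "v = Poly_Mapping.lookup (Abs_poly_mapping v)"
    by simp
  also have "Abs_poly_mapping v = (Abs_poly_mapping v - b) + b"
    using \<open>u \<le> v\<close> b(1) by (intro poly_mapping_eqI) (simp add: lookup_add lookup_minus le_fun_def)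
  also have "Poly_Mapping.lookup ((Abs_poly_mapping v - b) + b) \<in> exps I"
    using ideal_poly_ringD(3)[OF assms b(2), of "monomial (Abs_poly_mapping v - b)"]
    by (simp add: monomial_mult)
  finally show "v \<in> exps I" .
qed

lemma sum_monomials:
  fixes f :: "('v, 'k::comm_ring_1) mpoly"
  shows "f = (\<Sum>b\<in>Poly_Mapping.keys f. Poly_Mapping.single 0 (Poly_Mapping.lookup f b) * monomial b)"
proof (rule poly_mapping_eqI)
  fix c
  show "Poly_Mapping.lookup f c = Poly_Mapping.lookup
    (\<Sum>b\<in>Poly_Mapping.keys f. Poly_Mapping.single 0 (Poly_Mapping.lookup f b) * monomial b) c"
    by (simp add: monomial_def mult_single lookup_sum lookup_single when_def in_keys_iff)
qed

lemma supported_exps_subset: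
  fixes I :: "('v, 'k::comm_ring_1) mpoly set"
  assumes "ideal I poly_ring"
  shows "supported (exps I) \<subseteq> I"
proof
  fix f :: "('v, 'k) mpoly" assume f: "f \<in> supported (exps I)"
  note D = ideal_poly_ringD[OF assms]
  have "(\<Sum>b\<in>B. Poly_Mapping.single 0 (Poly_Mapping.lookup f b) * monomial b) \<in> I"
    if "finite B" "B \<subseteq> Poly_Mapping.keys f" for B
    using that
  proof induction
    case (insert b B)
    moreover have "monomial b \<in> I"
      using f insert.prems by (auto simp: supported_def)
    ultimately show ?case
      using D(2) D(3)[of "monomial b"] by simp
  qed (simp add: D)
  then show "f \<in> I"
    by (subst sum_monomials[of f]) simp
qed

lemma monomial_ideal_ideal: "monomial_ideal I \<Longrightarrow> ideal I poly_ring"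
  unfolding monomial_ideal_def using ring.genideal_ideal[OF ring_poly_ring] by auto

lemma monomial_ideal_eq_supported:
  fixes I :: "('v, 'k::comm_ring_1) mpoly set"
  assumes "monomial_ideal I"
  shows "I = supported (exps I)"
proof
  obtain B where B: "I = Idl\<^bsub>poly_ring\<^esub> (monomial ` B)"
    using assms unfolding monomial_ideal_def by blast
  note ideal = monomial_ideal_ideal[OF assms]
  \<comment> \<open>The polynomials whose monomials are all divisible by a generator form an ideal
    containing the generators, hence containing \<open>I\<close>.\<close>
  define J :: "('v, 'k) mpoly set" where
    "J = {f. \<forall>b \<in> Poly_Mapping.keys f. \<exists>c \<in> B. \<exists>d. b = d + c}"
  have "ideal J poly_ring"
  proof (rule ideal_poly_ringI)
    fix f h assume f: "f \<in> J"
    show "h * f \<in> J"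
      unfolding J_def
    proof (intro CollectI ballI)
      fix b assume "b \<in> Poly_Mapping.keys (h * f)"
      then obtain p q where "b = p + q" "q \<in> Poly_Mapping.keys f"
        using keys_mult[of h f] by blast
      moreover from this obtain c d where "c \<in> B" "q = d + c"
        using f by (auto simp: J_def)
      ultimately show "\<exists>c \<in> B. \<exists>d. b = d + c"
        by (metis add.assoc)
    qed
  next
    fix f g assume "f \<in> J" "g \<in> J"
    then show "f + g \<in> J"
      unfolding J_def using keys_add[of f g] by blast
  qed (simp add: J_def)
  moreover have "monomial ` B \<subseteq> J"
    by (auto simp: J_def monomial_def) (metis add_0)
  ultimately have "I \<subseteq> J"
    unfolding B by (rule ring.genideal_minimal[OF ring_poly_ring])
  have "monomial c \<in> I" if "c \<in> B" for c
    using ring.genideal_self[OF ring_poly_ring, of "monomial ` B"] that B by auto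
  then have "monomial (d + c) \<in> I" if "c \<in> B" for c d
    using ideal_poly_ringD(3)[OF ideal, of "monomial c" "monomial d"] that by (simp add: monomial_mult)
  then show "I \<subseteq> supported (exps I)"
    using \<open>I \<subseteq> J\<close> by (fastforce simp: J_def supported_def)
  show "supported (exps I) \<subseteq> I"
    by (rule supported_exps_subset[OF ideal])
qed

section \<open>The modules \<open>I\<close> and \<open>S/I\<close>\<close>

lemma ideal_module_simps [simp]:
  "carrier (ideal_module poly_ring I) = I" "zero (ideal_module poly_ring I) = 0"
  "add (ideal_module poly_ring I) = (+)" "smult (ideal_module poly_ring I) = (*)"
  by (simp_all add: ideal_module_def)

lemma module_ideal_module:
  fixes I :: "('v, 'k::comm_ring_1) mpoly set"
  assumes "ideal I poly_ring"
  shows "Module.module poly_ring (ideal_module poly_ring I)"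
proof (rule moduleI)
  show "abelian_group (ideal_module poly_ring I)"
  proof (rule abelian_groupI)
    fix f assume "f \<in> carrier (ideal_module poly_ring I)"
    then show "\<exists>g \<in> carrier (ideal_module poly_ring I).
        g \<oplus>\<^bsub>ideal_module poly_ring I\<^esub> f = \<zero>\<^bsub>ideal_module poly_ring I\<^esub>"
      using ideal_poly_ringD(5)[OF assms] by (intro bexI[of _ "- f"]) auto
  qed (use ideal_poly_ringD[OF assms] in \<open>auto simp: algebra_simps\<close>)
qed (use ideal_poly_ringD(3)[OF assms] cring_poly_ring in
    \<open>auto simp: distrib_left distrib_right mult.assoc\<close>)

abbreviation coset :: "('v, 'k::comm_ring_1) mpoly set \<Rightarrow> ('v, 'k) mpoly \<Rightarrow> ('v, 'k) mpoly set" where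
  "coset I f \<equiv> I +>\<^bsub>poly_ring\<^esub> f"

lemma coset_eq_iff:
  assumes "ideal I poly_ring"
  shows "coset I f = coset I g \<longleftrightarrow> f - g \<in> I"
proof
  note D = ideal_poly_ringD[OF assms]
  have coset: "coset I h = {p. p - h \<in> I}" for h
    by (force simp: a_r_coset_def')
  show "coset I f = coset I g" if "f - g \<in> I"
  proof -
    have "p - f \<in> I \<longleftrightarrow> p - g \<in> I" for p
      using D(2)[OF _ that, of "p - f"] D(6)[OF _ that, of "p - g"] by auto
    then show ?thesis
      unfolding coset by blast
  qed
  show "f - g \<in> I" if "coset I f = coset I g"
  proof -
    have "f \<in> {p. p - f \<in> I}"
      using D(1) by simp
    then show ?thesis
      using that unfolding coset by blast
  qed
qed

lemma quotient_module_simps: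
  fixes I :: "('v, 'k::comm_ring_1) mpoly set"
  assumes "ideal I poly_ring"
  shows "carrier (quotient_module poly_ring I) = range (coset I)"
    "zero (quotient_module poly_ring I) = coset I 0"
    "coset I f \<oplus>\<^bsub>quotient_module poly_ring I\<^esub> coset I g = coset I (f + g)"
    "f \<odot>\<^bsub>quotient_module poly_ring I\<^esub> coset I g = coset I (f * g)"
proof -
  interpret ideal I poly_ring
    by fact
  show "carrier (quotient_module poly_ring I) = range (coset I)"
    by (auto simp: quotient_module_def FactRing_def A_RCOSETS_def')
  have "coset I 0 = I"
    using a_rcos_const[of 0] ideal_poly_ringD(1)[OF assms] by simp
  then show "zero (quotient_module poly_ring I) = coset I 0"
    by (simp add: quotient_module_def FactRing_def)
  show "coset I f \<oplus>\<^bsub>quotient_module poly_ring I\<^esub> coset I g = coset I (f + g)"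
    using a_rcos_sum[of f g] by (simp add: quotient_module_def FactRing_def)
  show "f \<odot>\<^bsub>quotient_module poly_ring I\<^esub> coset I g = coset I (f * g)"
    using rcoset_mult_add[of f g] by (simp add: quotient_module_def FactRing_def)
qed

lemma module_quotient_module:
  fixes I :: "('v, 'k::comm_ring_1) mpoly set"
  assumes "ideal I poly_ring"
  shows "Module.module poly_ring (quotient_module poly_ring I)"
proof (rule moduleI)
  note S = quotient_module_simps[OF assms]
  show "abelian_group (quotient_module poly_ring I)"
  proof (rule abelian_groupI)
    fix X assume "X \<in> carrier (quotient_module poly_ring I)"
    then obtain f where "X = coset I f"
      by (auto simp: S)
    then show "\<exists>Y \<in> carrier (quotient_module poly_ring I).
        Y \<oplus>\<^bsub>quotient_module poly_ring I\<^esub> X = \<zero>\<^bsub>quotient_module poly_ring I\<^esub>"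
      by (intro bexI[of _ "coset I (- f)"]) (simp_all add: S)
  qed (auto simp: S algebra_simps)
qed (use cring_poly_ring in \<open>auto simp: quotient_module_simps[OF assms] algebra_simps\<close>)

text \<open>Additivity is only asked on \<open>C\<close>, because in \<open>monomial_module\<close>
  the map is controlled only on polynomials supported in \<open>T\<close>.\<close>

lemma finsum_additive:
  assumes "abelian_monoid M" "finite A"
    and "\<And>f g. f \<in> C \<Longrightarrow> g \<in> C \<Longrightarrow> f + g \<in> C" "0 \<in> C"
    and "\<And>f g. f \<in> C \<Longrightarrow> g \<in> C \<Longrightarrow> \<psi> (f + g) = \<psi> f \<oplus>\<^bsub>M\<^esub> \<psi> g" "\<psi> 0 = \<zero>\<^bsub>M\<^esub>"
    and "\<psi> ` C \<subseteq> carrier M" "\<And>i. i \<in> A \<Longrightarrow> c i \<in> C"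
  shows "(\<Oplus>\<^bsub>M\<^esub>i\<in>A. \<psi> (c i)) = \<psi> (\<Sum>i\<in>A. c i)"
proof -
  interpret abelian_monoid M
    by fact
  have "(\<Oplus>\<^bsub>M\<^esub>i\<in>A. \<psi> (c i)) = \<psi> (\<Sum>i\<in>A. c i) \<and> (\<Sum>i\<in>A. c i) \<in> C"
    using assms(2,8)
  proof induction
    case (insert i A)
    have "(\<lambda>i. \<psi> (c i)) \<in> A \<rightarrow> carrier M" "\<psi> (c i) \<in> carrier M"
      using insert.prems assms(7) by auto
    then show ?case
      using insert assms(3,5) by (simp add: finsum_insert)
  qed (use assms(4,6) in simp)
  then show ?thesis ..
qed

section \<open>Stanley decompositions from box partitions\<close>

text \<open>
  Both \<open>I\<close> and \<open>S/I\<close> have a \<open>K\<close>-basis of monomials, whose exponents form the set \<open>T\<close>.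
\<close>

locale monomial_module =
  fixes M :: "(('v::finite, 'k::field) mpoly, 'm) module"
    and G :: "('v \<Rightarrow> int) \<Rightarrow> 'm set"
    and T :: "('v \<Rightarrow> nat) set"
    and \<psi> :: "('v, 'k) mpoly \<Rightarrow> 'm"
  assumes monoid: "abelian_monoid M"
    and bij: "bij_betw \<psi> (supported T) (carrier M)"
    and additive: "f \<in> supported T \<Longrightarrow> g \<in> supported T \<Longrightarrow> \<psi> (f + g) = \<psi> f \<oplus>\<^bsub>M\<^esub> \<psi> g"
    and zero: "\<psi> 0 = \<zero>\<^bsub>M\<^esub>"
    and smult: "g \<in> supported T \<Longrightarrow> f * g \<in> supported T \<Longrightarrow> f \<odot>\<^bsub>M\<^esub> \<psi> g = \<psi> (f * g)"
    and graded: "Poly_Mapping.lookup b \<in> T \<Longrightarrow> \<psi> (monomial b) \<in> G (\<lambda>i. int (Poly_Mapping.lookup b i))"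
begin

sublocale abelian_monoid M
  by (rule monoid)

lemma \<psi>_closed: "f \<in> supported T \<Longrightarrow> \<psi> f \<in> carrier M"
  using bij by (auto simp: bij_betw_def)

lemma \<psi>_inject: "\<psi> f = \<psi> g \<Longrightarrow> f \<in> supported T \<Longrightarrow> g \<in> supported T \<Longrightarrow> f = g"
  using bij by (auto simp: bij_betw_def inj_on_def)

lemma times_monomial_supported:
  assumes "box (Poly_Mapping.lookup b) Z \<subseteq> T" "f \<in> subpoly Z"
  shows "f * monomial b \<in> supported T"
proof -
  have "f * monomial b \<in> supported (box (Poly_Mapping.lookup b) Z)"
    using assms(2) subpoly_times_monomial[of b Z] by blast
  then show ?thesis
    using assms(1) by (rule supported_mono)
qed

lemma monomial_supported:
  "box (Poly_Mapping.lookup b) Z \<subseteq> T \<Longrightarrow> monomial b \<in> supported T"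
  using self_in_box by (intro monomial_in_supported) blast

lemma smult_monomial:
  assumes "box (Poly_Mapping.lookup b) Z \<subseteq> T" "f \<in> subpoly Z"
  shows "f \<odot>\<^bsub>M\<^esub> \<psi> (monomial b) = \<psi> (f * monomial b)"
  using assms monomial_supported times_monomial_supported smult by blast

lemma stanley_space_eq:
  assumes "box (Poly_Mapping.lookup b) Z \<subseteq> T"
  shows "stanley_space M (\<psi> (monomial b)) Z = \<psi> ` supported (box (Poly_Mapping.lookup b) Z)"
proof -
  have "stanley_space M (\<psi> (monomial b)) Z = (\<lambda>f. \<psi> (f * monomial b)) ` subpoly Z"
    unfolding stanley_space_def using smult_monomial[OF assms] by (intro image_cong) auto
  also have "\<dots> = \<psi> ` (\<lambda>f. f * monomial b) ` subpoly Z"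
    by (simp add: image_image)
  finally show ?thesis
    by (simp only: subpoly_times_monomial)
qed

text \<open>The single element \<open>m\<close> is a basis: the coefficient is unique because
  \<open>\<psi>\<close> is injective on polynomials supported in \<open>T\<close> and multiplication
  by a monomial is injective.\<close>

lemma free_over_stanley_space:
  assumes box: "box (Poly_Mapping.lookup b) Z \<subseteq> T"
  shows "free_over M poly_ring (subpoly Z) (stanley_space M (\<psi> (monomial b)) Z)"
proof -
  define m where "m = \<psi> (monomial b)"
  have m: "m \<in> stanley_space M m Z"
    unfolding m_def stanley_space_eq[OF box]
    by (intro imageI monomial_in_supported self_in_box)
  have sum: "(\<Oplus>\<^bsub>M\<^esub>x\<in>{x \<in> {m}. c x \<noteq> \<zero>\<^bsub>poly_ring\<^esub>}. c x \<odot>\<^bsub>M\<^esub> x) = \<psi> (c m * monomial b)"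
    if "c m \<in> subpoly Z" for c
  proof (cases "c m = 0")
    case True
    then have "{x \<in> {m}. c x \<noteq> \<zero>\<^bsub>poly_ring\<^esub>} = {}"
      by auto
    then show ?thesis
      using True by (simp only: finsum_empty) (simp add: zero)
  next
    case False
    then have "{x \<in> {m}. c x \<noteq> \<zero>\<^bsub>poly_ring\<^esub>} = {m}"
      by auto
    moreover have "c m \<odot>\<^bsub>M\<^esub> m = \<psi> (c m * monomial b)"
      using smult_monomial[OF box that] by (simp add: m_def)
    moreover have "\<psi> (c m * monomial b) \<in> carrier M"
      using \<psi>_closed times_monomial_supported[OF box that] by blast
    ultimately show ?thesis
      using finsum_insert[of "{}" m "\<lambda>x. c x \<odot>\<^bsub>M\<^esub> x"] by simp
  qed
  have "\<exists>!c. c \<in> {m} \<rightarrow>\<^sub>E subpoly Z \<and> finite {x \<in> {m}. c x \<noteq> \<zero>\<^bsub>poly_ring\<^esub>} \<and>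
      y = (\<Oplus>\<^bsub>M\<^esub>x\<in>{x \<in> {m}. c x \<noteq> \<zero>\<^bsub>poly_ring\<^esub>}. c x \<odot>\<^bsub>M\<^esub> x)"
    if y: "y \<in> stanley_space M m Z" for y
  proof -
    obtain f where f: "f \<in> subpoly Z" "y = \<psi> (f * monomial b)"
      using y smult_monomial[OF box] by (auto simp: stanley_space_def m_def)
    show ?thesis
    proof (rule ex1I[of _ "\<lambda>x\<in>{m}. f"])
      show "(\<lambda>x\<in>{m}. f) \<in> {m} \<rightarrow>\<^sub>E subpoly Z \<and> finite {x \<in> {m}. (\<lambda>x\<in>{m}. f) x \<noteq> \<zero>\<^bsub>poly_ring\<^esub>} \<and>
        y = (\<Oplus>\<^bsub>M\<^esub>x\<in>{x \<in> {m}. (\<lambda>x\<in>{m}. f) x \<noteq> \<zero>\<^bsub>poly_ring\<^esub>}. (\<lambda>x\<in>{m}. f) x \<odot>\<^bsub>M\<^esub> x)"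
        using f sum[of "\<lambda>x\<in>{m}. f"] by simp
    next
      fix c
      assume c: "c \<in> {m} \<rightarrow>\<^sub>E subpoly Z \<and> finite {x \<in> {m}. c x \<noteq> \<zero>\<^bsub>poly_ring\<^esub>} \<and>
        y = (\<Oplus>\<^bsub>M\<^esub>x\<in>{x \<in> {m}. c x \<noteq> \<zero>\<^bsub>poly_ring\<^esub>}. c x \<odot>\<^bsub>M\<^esub> x)"
      then have cm: "c m \<in> subpoly Z"
        by auto
      have "y = (\<Oplus>\<^bsub>M\<^esub>x\<in>{x \<in> {m}. c x \<noteq> \<zero>\<^bsub>poly_ring\<^esub>}. c x \<odot>\<^bsub>M\<^esub> x)"
        using c by blast
      also have "\<dots> = \<psi> (c m * monomial b)"
        by (rule sum) (rule cm)
      finally have "c m * monomial b = f * monomial b"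
        using \<psi>_inject times_monomial_supported[OF box] cm f by metis
      then have "c m = f"
        by (rule times_monomial_inject)
      then show "c = (\<lambda>x\<in>{m}. f)"
        using c by (intro PiE_ext[of _ "{m}" "\<lambda>_. subpoly Z"]) (auto simp: f(1))
    qed
  qed
  then show ?thesis
    unfolding free_over_def m_def[symmetric] using m by (intro exI[of _ "{m}"]) blast
qed

text \<open>A polynomial splits into its restrictions to the boxes. Disjointness lets each
  coefficient of a sum of box-supported polynomials be read off from a single summand, which gives
  uniqueness.\<close>

lemma direct_sum_supported:
  assumes ps: "distinct ps" "box_partition (set ps) T"
    and N: "\<And>i. i < length ps \<Longrightarrow> N i = \<psi> ` supported (box (fst (ps ! i)) (snd (ps ! i)))"
  shows "direct_sum M (length ps) N"
proof -
  define B where "B i = box (fst (ps ! i)) (snd (ps ! i))" for i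
  have N: "N i = \<psi> ` supported (B i)" if "i < length ps" for i
    using N that by (simp add: B_def)
  have B_sub: "B i \<subseteq> T" if "i < length ps" for i
    using ps(2) nth_mem[OF that] by (auto simp: box_partition_def B_def split_beta)
  have B_ex: "\<exists>i < length ps. u \<in> B i" if "u \<in> T" for u
    using ps(2) that unfolding box_partition_def B_def in_set_conv_nth by metis
  have B_disj: "i = j" if "i < length ps" "j < length ps" "u \<in> B i" "u \<in> B j" for i j u
  proof -
    have "\<exists>!p. p \<in> set ps \<and> u \<in> box (fst p) (snd p)"
      using ps(2) B_sub that unfolding box_partition_def by blast
    then have "ps ! i = ps ! j"
      using that nth_mem unfolding B_def by blast
    then show ?thesis
      using ps(1) that by (simp add: nth_eq_iff_index_eq)
  qed
  have supp: "f \<in> supported T" if "i < length ps" "f \<in> supported (B i)" for i f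
    using that B_sub supported_mono by blast
  have sum: "(\<Oplus>\<^bsub>M\<^esub>i\<in>{..<length ps}. \<psi> (g i)) = \<psi> (\<Sum>i<length ps. g i)"
    if "\<And>i. i < length ps \<Longrightarrow> g i \<in> supported (B i)" for g
    using that supp
    by (intro finsum_additive[OF monoid, where C = "supported T"])
      (auto simp: zero additive supported_add \<psi>_closed)
  have lookup_sum_eq: "Poly_Mapping.lookup (\<Sum>i<length ps. g i) b = Poly_Mapping.lookup (g i) b"
    if g: "\<And>i. i < length ps \<Longrightarrow> g i \<in> supported (B i)"
      and i: "i < length ps" "Poly_Mapping.lookup b \<in> B i" for g i and b
  proof -
    have "Poly_Mapping.lookup (g j) b = (if j = i then Poly_Mapping.lookup (g i) b else 0)"
      if "j < length ps" for j
      using g[OF that] B_disj[OF that i(1) _ i(2)] by (auto simp: supported_iff)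
    then have "Poly_Mapping.lookup (\<Sum>i<length ps. g i) b =
        (\<Sum>j<length ps. if j = i then Poly_Mapping.lookup (g i) b else 0)"
      by (simp add: lookup_sum)
    then show ?thesis
      using i(1) by simp
  qed
  have unique: "\<exists>!c. c \<in> (\<Pi>\<^sub>E i\<in>{..<length ps}. N i) \<and> y = (\<Oplus>\<^bsub>M\<^esub>i\<in>{..<length ps}. c i)"
    if y: "y \<in> carrier M" for y
  proof -
    obtain f where f: "f \<in> supported T" "y = \<psi> f"
      using y bij by (auto simp: bij_betw_def)
    have f_eq: "(\<Sum>i<length ps. restr (B i) f) = f"
    proof (rule poly_mapping_eqI)
      fix b
      show "Poly_Mapping.lookup (\<Sum>i<length ps. restr (B i) f) b = Poly_Mapping.lookup f b"
      proof (cases "Poly_Mapping.lookup b \<in> T")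
        case True
        then obtain i where i: "i < length ps" "Poly_Mapping.lookup b \<in> B i"
          using B_ex by blast
        then show ?thesis
          by (subst lookup_sum_eq[OF _ i]) (auto simp: restr_supported lookup_restr)
      next
        case False
        have "(\<Sum>i<length ps. restr (B i) f) \<in> supported T"
          by (intro supported_sum) (use supp restr_supported in blast)
        then show ?thesis
          using False f(1) unfolding supported_iff by metis
      qed
    qed
    have c0: "(\<Oplus>\<^bsub>M\<^esub>i\<in>{..<length ps}. (\<lambda>i\<in>{..<length ps}. \<psi> (restr (B i) f)) i) = y"
    proof -
      have "(\<Oplus>\<^bsub>M\<^esub>i\<in>{..<length ps}. (\<lambda>i\<in>{..<length ps}. \<psi> (restr (B i) f)) i) =
          (\<Oplus>\<^bsub>M\<^esub>i\<in>{..<length ps}. \<psi> (restr (B i) f))"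
        using supp restr_supported \<psi>_closed by (intro finsum_cong') (auto, blast)
      then show ?thesis
        using sum[of "\<lambda>i. restr (B i) f"] f_eq f(2) by (simp add: restr_supported)
    qed
    show ?thesis
    proof (rule ex1I[of _ "\<lambda>i\<in>{..<length ps}. \<psi> (restr (B i) f)"])
      show "(\<lambda>i\<in>{..<length ps}. \<psi> (restr (B i) f)) \<in> (\<Pi>\<^sub>E i\<in>{..<length ps}. N i) \<and>
        y = (\<Oplus>\<^bsub>M\<^esub>i\<in>{..<length ps}. (\<lambda>i\<in>{..<length ps}. \<psi> (restr (B i) f)) i)"
        using c0 N by (auto intro!: imageI restr_supported)
    next
      fix c assume c: "c \<in> (\<Pi>\<^sub>E i\<in>{..<length ps}. N i) \<and> y = (\<Oplus>\<^bsub>M\<^esub>i\<in>{..<length ps}. c i)"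
      then have "\<forall>i \<in> {..<length ps}. \<exists>g. g \<in> supported (B i) \<and> c i = \<psi> g"
        using N by (fastforce simp: PiE_iff)
      then obtain g where g: "\<And>i. i < length ps \<Longrightarrow> g i \<in> supported (B i)"
        "\<And>i. i < length ps \<Longrightarrow> c i = \<psi> (g i)"
        by (metis lessThan_iff)
      have "(\<Oplus>\<^bsub>M\<^esub>i\<in>{..<length ps}. c i) = (\<Oplus>\<^bsub>M\<^esub>i\<in>{..<length ps}. \<psi> (g i))"
        using g(2) \<psi>_closed[OF supp[OF _ g(1)]] by (intro finsum_cong') auto
      then have "\<psi> (\<Sum>i<length ps. g i) = \<psi> f"
        using c f(2) sum[OF g(1)] by simp
      moreover have "(\<Sum>i<length ps. g i) \<in> supported T"
        using g(1) supp by (intro supported_sum) auto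
      ultimately have f_sum: "(\<Sum>i<length ps. g i) = f"
        using \<psi>_inject f(1) by blast
      have "g i = restr (B i) f" if i: "i < length ps" for i
      proof (rule poly_mapping_eqI)
        fix b
        show "Poly_Mapping.lookup (g i) b = Poly_Mapping.lookup (restr (B i) f) b"
          using lookup_sum_eq[OF g(1) i, of b] g(1)[OF i] f_sum
          by (auto simp: lookup_restr supported_iff)
      qed
      then have "c i = \<psi> (restr (B i) f)" if "i < length ps" for i
        using g(2) that by metis
      moreover have "c \<in> extensional {..<length ps}"
        using c by (simp add: PiE_iff)
      ultimately show "c = (\<lambda>i\<in>{..<length ps}. \<psi> (restr (B i) f))"
        by (intro extensionalityI[where A = "{..<length ps}"]) auto
    qed
  qed
  have closed: "N i \<subseteq> carrier M" if "i < length ps" for i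
    using N[OF that] supp[OF that] \<psi>_closed by auto
  show ?thesis
    unfolding direct_sum_def by (intro conjI allI impI ballI closed unique)
qed

text \<open>Only the sets of variables are remembered, since they determine
  \<open>sdepth_decomposition\<close>. Nonemptiness of \<open>T\<close> provides the nonempty
  list.\<close>

lemma stanley_decomposition_exists:
  assumes "box_partition P T" "T \<noteq> {}"
  shows "\<exists>D. stanley_decomposition M G D \<and> snd ` set D = snd ` P"
proof -
  have "finite P"
    using assms(1) by (simp add: box_partition_def)
  then obtain ps where ps: "set ps = P" "distinct ps"
    using finite_distinct_list by blast
  define D where "D = map (\<lambda>(a, Z). (\<psi> (monomial (Abs_poly_mapping a)), Z)) ps"
  have box_sub: "box a Z \<subseteq> T" if "(a, Z) \<in> P" for a Z
    using assms(1) that by (auto simp: box_partition_def)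
  have "ps \<noteq> []"
    using assms ps(1) by (auto simp: box_partition_def)
  have "stanley_decomposition M G D"
    unfolding stanley_decomposition_def
  proof (intro conjI ballI)
    show "D \<noteq> []"
      using \<open>ps \<noteq> []\<close> by (simp add: D_def)
  next
    fix mZ assume "mZ \<in> set D"
    then obtain a Z where aZ: "(a, Z) \<in> P" "mZ = (\<psi> (monomial (Abs_poly_mapping a)), Z)"
      using ps(1) by (auto simp: D_def)
    have sub: "box (Poly_Mapping.lookup (Abs_poly_mapping a)) Z \<subseteq> T"
      using box_sub[OF aZ(1)] by simp
    then have "a \<in> T"
      using self_in_box by auto
    then have "\<exists>d. \<psi> (monomial (Abs_poly_mapping a)) \<in> G d"
      using graded[of "Abs_poly_mapping a"] by auto
    then show "case mZ of (m, Z) \<Rightarrow> (\<exists>a. m \<in> G a) \<and>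
        free_over M poly_ring (subpoly Z) (stanley_space M m Z)"
      using free_over_stanley_space[OF sub] aZ(2) by simp
  next
    have "direct_sum M (length ps) (\<lambda>i. stanley_space M (fst (D ! i)) (snd (D ! i)))"
    proof (rule direct_sum_supported)
      fix i assume i: "i < length ps"
      obtain a Z where aZ: "ps ! i = (a, Z)"
        by force
      then have "box (Poly_Mapping.lookup (Abs_poly_mapping a)) Z \<subseteq> T"
        using box_sub[of a Z] nth_mem[OF i] ps(1) by simp
      from stanley_space_eq[OF this]
      show "stanley_space M (fst (D ! i)) (snd (D ! i)) =
          \<psi> ` supported (box (fst (ps ! i)) (snd (ps ! i)))"
        using i aZ by (simp add: D_def)
    qed (use ps assms in auto)
    then show "direct_sum M (length D) (\<lambda>i. stanley_space M (fst (D ! i)) (snd (D ! i)))"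
      by (simp add: D_def)
  qed
  moreover have "snd ` set D = snd ` P"
    by (force simp: D_def ps(1)[symmetric])
  ultimately show ?thesis
    by blast
qed

end

lemma ideal_monomial_module:
  fixes I :: "('v::finite, 'k::field) mpoly set"
  assumes "ideal I poly_ring" "I = supported (exps I)"
  shows "monomial_module (ideal_module poly_ring I) (ideal_component I) (exps I) (\<lambda>f. f)"
proof (rule monomial_module.intro)
  interpret Module.module poly_ring "ideal_module poly_ring I"
    by (rule module_ideal_module) fact
  show "abelian_monoid (ideal_module poly_ring I)"
    by (rule M.abelian_monoid_axioms)
  show "bij_betw (\<lambda>f. f) (supported (exps I)) (carrier (ideal_module poly_ring I))"
    using assms(2) by (simp add: bij_betw_def inj_on_def)
  show "monomial b \<in> ideal_component I (\<lambda>i. int (Poly_Mapping.lookup b i))"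
    if "Poly_Mapping.lookup b \<in> exps I" for b
    using that by (auto simp: ideal_component_def poly_component_def monomial_def)
qed auto

text \<open>Deleting the monomials of \<open>I\<close> from a polynomial gives its normal form
  modulo \<open>I\<close>. Two normal forms in one coset differ by an element of \<open>I\<close>
  with support outside \<open>exps I\<close>, which is 0.\<close>

lemma quotient_monomial_module:
  fixes I :: "('v::finite, 'k::field) mpoly set"
  assumes ideal: "ideal I poly_ring" and I: "I = supported (exps I)"
  shows "monomial_module (quotient_module poly_ring I) (quotient_component I) (- exps I) (coset I)"
proof (rule monomial_module.intro)
  interpret Module.module poly_ring "quotient_module poly_ring I"
    by (rule module_quotient_module) fact
  show "abelian_monoid (quotient_module poly_ring I)"
    by (rule M.abelian_monoid_axioms)
  have "f = g" if "coset I f = coset I g" "f \<in> supported (- exps I)" "g \<in> supported (- exps I)" for f g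
  proof -
    have "f - g \<in> supported (exps I)"
      using that(1) coset_eq_iff[OF ideal] I by blast
    then have "f - g = 0"
      using supported_Int_Compl supported_diff[OF that(2,3)] by blast
    then show ?thesis
      by simp
  qed
  moreover have "coset I f \<in> coset I ` supported (- exps I)" for f
  proof -
    have "f - restr (- exps I) f \<in> supported (exps I)"
      by (auto simp: supported_iff lookup_minus lookup_restr split: if_splits)
    then have "coset I f = coset I (restr (- exps I) f)"
      using coset_eq_iff[OF ideal] I by blast
    then show ?thesis
      using restr_supported by blast
  qed
  ultimately show "bij_betw (coset I) (supported (- exps I)) (carrier (quotient_module poly_ring I))"
    by (auto simp: bij_betw_def inj_on_def quotient_module_simps[OF ideal])
  show "coset I (monomial b) \<in> quotient_component I (\<lambda>i. int (Poly_Mapping.lookup b i))" for b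
    by (auto simp: quotient_component_def poly_component_def monomial_def)
qed (simp_all add: quotient_module_simps[OF ideal])

section \<open>Boxes in the complement of an ideal\<close>

text \<open>
  The basis of \<open>m K[Z]\<close> need not be \<open>m\<close>: if \<open>s m = 0\<close>, then multiplying the coefficients of
  \<open>m\<close> with \<open>s\<close> yields the coefficients of \<open>0\<close>.
\<close>

lemma free_stanley_space_no_torsion:
  fixes M :: "(('v, 'k::field) mpoly, 'm) module"
  assumes "Module.module poly_ring M" "m \<in> carrier M"
    and free: "free_over M poly_ring (subpoly Z) (stanley_space M m Z)"
    and p: "Poly_Mapping.keys p \<subseteq> Z" and null: "monomial p \<odot>\<^bsub>M\<^esub> m = \<zero>\<^bsub>M\<^esub>"
  shows "m = \<zero>\<^bsub>M\<^esub>"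
proof -
  interpret Module.module poly_ring M
    by fact
  let ?s = "monomial p :: ('v, 'k) mpoly"
  obtain B where B: "B \<subseteq> stanley_space M m Z"
    and ex1: "\<And>y. y \<in> stanley_space M m Z \<Longrightarrow>
      \<exists>!c. c \<in> B \<rightarrow>\<^sub>E subpoly Z \<and> finite {b \<in> B. c b \<noteq> 0} \<and>
        y = (\<Oplus>\<^bsub>M\<^esub>b\<in>{b \<in> B. c b \<noteq> 0}. c b \<odot>\<^bsub>M\<^esub> b)"
    using free by (auto simp: free_over_def)
  have "m = 1 \<odot>\<^bsub>M\<^esub> m" "\<zero>\<^bsub>M\<^esub> = 0 \<odot>\<^bsub>M\<^esub> m"
    using smult_one[OF assms(2)] smult_l_null[OF assms(2)] by simp_all
  moreover have "(1 :: ('v, 'k) mpoly) \<in> subpoly Z" "(0 :: ('v, 'k) mpoly) \<in> subpoly Z"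
    by (simp_all add: subpoly_def)
  ultimately have m: "m \<in> stanley_space M m Z" and zero: "\<zero>\<^bsub>M\<^esub> \<in> stanley_space M m Z"
    unfolding stanley_space_def by (blast intro: image_eqI)+
  have B_closed: "B \<subseteq> carrier M"
    using B smult_closed[OF _ assms(2)] by (auto simp: stanley_space_def)
  obtain c where c: "c \<in> B \<rightarrow>\<^sub>E subpoly Z" "finite {b \<in> B. c b \<noteq> 0}"
    "m = (\<Oplus>\<^bsub>M\<^esub>b\<in>{b \<in> B. c b \<noteq> 0}. c b \<odot>\<^bsub>M\<^esub> b)"
    using ex1[OF m] by blast
  have s_iff: "?s * f = 0 \<longleftrightarrow> f = 0" for f
    using times_monomial_inject[of f p 0] by (auto simp: mult.commute)
  have s_sub: "?s \<in> subpoly Z"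
    using p by (simp add: subpoly_def monomial_def)
  \<comment> \<open>Multiplication by a monomial kills no nonzero coefficient, so \<open>c'\<close>
    has the support of \<open>c\<close>, while it represents 0. Uniqueness then forces
    \<open>c' = c0\<close>, and the support of \<open>c\<close> is empty.\<close>
  define c' where "c' = (\<lambda>b\<in>B. ?s * c b)"
  have supp: "{b \<in> B. c' b \<noteq> 0} = {b \<in> B. c b \<noteq> 0}"
    by (auto simp: c'_def s_iff)
  have "\<zero>\<^bsub>M\<^esub> = (\<Oplus>\<^bsub>M\<^esub>b\<in>{b \<in> B. c b \<noteq> 0}. ?s \<odot>\<^bsub>M\<^esub> (c b \<odot>\<^bsub>M\<^esub> b))"
  proof -
    have "(\<lambda>b. c b \<odot>\<^bsub>M\<^esub> b) \<in> {b \<in> B. c b \<noteq> 0} \<rightarrow> carrier M"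
      using B_closed smult_closed by auto
    then show ?thesis
      using null finsum_smult_ldistr[OF c(2), of ?s "\<lambda>b. c b \<odot>\<^bsub>M\<^esub> b"] c(3) by simp
  qed
  also have "\<dots> = (\<Oplus>\<^bsub>M\<^esub>b\<in>{b \<in> B. c' b \<noteq> 0}. c' b \<odot>\<^bsub>M\<^esub> b)"
  proof (rule M.finsum_cong')
    fix b assume "b \<in> {b \<in> B. c' b \<noteq> 0}"
    then show "?s \<odot>\<^bsub>M\<^esub> (c b \<odot>\<^bsub>M\<^esub> b) = c' b \<odot>\<^bsub>M\<^esub> b"
      using smult_assoc1[of ?s "c b" b] B_closed by (auto simp: c'_def)
  qed (use supp B_closed smult_closed in auto)
  finally have c'_sum: "\<zero>\<^bsub>M\<^esub> = (\<Oplus>\<^bsub>M\<^esub>b\<in>{b \<in> B. c' b \<noteq> 0}. c' b \<odot>\<^bsub>M\<^esub> b)" .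
  have c'_in: "c' \<in> B \<rightarrow>\<^sub>E subpoly Z"
    using c(1) s_sub subpoly_mult by (auto simp: c'_def PiE_iff)
  define c0 where "c0 = (\<lambda>b\<in>B. 0 :: ('v, 'k) mpoly)"
  have c0: "c0 \<in> B \<rightarrow>\<^sub>E subpoly Z" "{b \<in> B. c0 b \<noteq> 0} = {}"
    by (auto simp: c0_def zero_in_subpoly)
  have "c' \<in> B \<rightarrow>\<^sub>E subpoly Z \<and> finite {b \<in> B. c' b \<noteq> 0} \<and>
      \<zero>\<^bsub>M\<^esub> = (\<Oplus>\<^bsub>M\<^esub>b\<in>{b \<in> B. c' b \<noteq> 0}. c' b \<odot>\<^bsub>M\<^esub> b)"
    using c'_in c'_sum c(2) supp by simp
  moreover have "c0 \<in> B \<rightarrow>\<^sub>E subpoly Z \<and> finite {b \<in> B. c0 b \<noteq> 0} \<and>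
      \<zero>\<^bsub>M\<^esub> = (\<Oplus>\<^bsub>M\<^esub>b\<in>{b \<in> B. c0 b \<noteq> 0}. c0 b \<odot>\<^bsub>M\<^esub> b)"
    using c0(1) unfolding c0(2) by simp
  ultimately have "c' = c0"
    using ex1[OF zero] by (elim alt_ex1E) blast
  then have empty: "{b \<in> B. c b \<noteq> 0} = {}"
    using supp c0(2) by simp
  show ?thesis
    using c(3) unfolding empty by simp
qed

text \<open>Let a monomial x^p of K[Z_i] times the monomial x^q of \<open>m i\<close> contribute to
  x^b. If x^(d+b) were in \<open>I\<close> with x^d in K[Z_i], then x^(d+p) would kill
  \<open>m i\<close>; freeness gives \<open>m i\<close> = 0, so x^q and its multiple x^b would be in
  \<open>I\<close>.\<close>

lemma quotient_stanley_decomposition_box: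
  fixes I :: "('v::finite, 'k::field) mpoly set"
  assumes ideal: "ideal I poly_ring" and I: "I = supported (exps I)"
    and D: "stanley_decomposition (quotient_module poly_ring I) (quotient_component I) D"
    and u: "u \<notin> exps I"
  shows "\<exists>(m, Z) \<in> set D. box u Z \<inter> exps I = {}"
proof -
  let ?M = "quotient_module poly_ring I"
  interpret Module.module poly_ring ?M
    by (rule module_quotient_module) fact
  note S = quotient_module_simps[OF ideal]
  note D' = D[unfolded stanley_decomposition_def]
  obtain b where b: "u = Poly_Mapping.lookup b"
    by (metis lookup_Abs_finite)
  define m where "m i = fst (D ! i)" for i
  define Z where "Z i = snd (D ! i)" for i
  have D_i: "(\<exists>a. m i \<in> quotient_component I a)"
    "free_over ?M poly_ring (subpoly (Z i)) (stanley_space ?M (m i) (Z i))" if "i < length D" for i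
    using D' nth_mem[OF that] by (auto simp: m_def Z_def split_beta)
  have "\<exists>g a. m i = coset I g \<and> g \<in> poly_component a" if "i < length D" for i
    using D_i(1)[OF that] by (auto simp: quotient_component_def)
  then obtain g a where g: "m i = coset I (g i)" "g i \<in> poly_component (a i)" if "i < length D" for i
    by metis
  have "coset I (monomial b) \<in> carrier ?M"
    by (simp add: S)
  moreover have "direct_sum ?M (length D) (\<lambda>i. stanley_space ?M (m i) (Z i))"
    using D' by (simp add: m_def Z_def)
  ultimately have "\<exists>!c. c \<in> (\<Pi>\<^sub>E i\<in>{..<length D}. stanley_space ?M (m i) (Z i)) \<and>
      coset I (monomial b) = (\<Oplus>\<^bsub>?M\<^esub>i\<in>{..<length D}. c i)"
    unfolding direct_sum_def by (elim conjE bspec)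
  then obtain c where c: "c \<in> (\<Pi>\<^sub>E i\<in>{..<length D}. stanley_space ?M (m i) (Z i))"
    "coset I (monomial b) = (\<Oplus>\<^bsub>?M\<^esub>i\<in>{..<length D}. c i)"
    by (elim ex1E conjE)
  have "\<exists>f. f \<in> subpoly (Z i) \<and> c i = coset I (f * g i)" if "i < length D" for i
    using c(1) g(1)[OF that] that by (fastforce simp: PiE_iff stanley_space_def S)
  then obtain f where f: "f i \<in> subpoly (Z i)" "c i = coset I (f i * g i)" if "i < length D" for i
    by metis
  have "(\<Oplus>\<^bsub>?M\<^esub>i\<in>{..<length D}. c i) = (\<Oplus>\<^bsub>?M\<^esub>i\<in>{..<length D}. coset I (f i * g i))"
    by (rule M.finsum_cong') (auto simp: S f(2))
  also have "\<dots> = coset I (\<Sum>i<length D. f i * g i)"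
    by (rule finsum_additive[where C = UNIV]) (auto simp: S M.abelian_monoid_axioms)
  finally have "monomial b - (\<Sum>i<length D. f i * g i) \<in> I"
    using c(2) coset_eq_iff[OF ideal] by simp
  moreover have "monomial b \<notin> I"
    using u b by simp
  \<comment> \<open>Elements of \<open>I\<close> have coefficient 0 at monomials outside
    \<open>I\<close>, so the sum has coefficient 1 at \<open>b\<close> and some summand
    contributes.\<close>
  ultimately have "Poly_Mapping.lookup (monomial b - (\<Sum>i<length D. f i * g i)) b = 0"
    by (rule lookup_eq_zero_of_monomial_notin[OF I])
  then have "(\<Sum>i<length D. Poly_Mapping.lookup (f i * g i) b) \<noteq> 0"
    by (simp add: lookup_minus lookup_sum monomial_def)
  then obtain i where i: "i < length D" "Poly_Mapping.lookup (f i * g i) b \<noteq> 0"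
    by (elim sum.not_neutral_contains_not_neutral) auto
  then have "b \<in> Poly_Mapping.keys (f i * g i)"
    by (simp add: in_keys_iff)
  then obtain p q where pq: "b = p + q" "p \<in> Poly_Mapping.keys (f i)" "q \<in> Poly_Mapping.keys (g i)"
    using keys_mult[of "f i" "g i"] by blast
  \<comment> \<open>Homogeneity of \<open>g i\<close> leaves it a single monomial.\<close>
  have "r = q" if "r \<in> Poly_Mapping.keys (g i)" for r
  proof (rule poly_mapping_eqI)
    fix j
    have "int (Poly_Mapping.lookup r j) = int (Poly_Mapping.lookup q j)"
      using g(2)[OF i(1)] that pq(3) by (simp add: poly_component_def)
    then show "Poly_Mapping.lookup r j = Poly_Mapping.lookup q j"
      by simp
  qed
  then have keys_g: "Poly_Mapping.keys (g i) = {q}"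
    using pq(3) by blast
  have "box u (Z i) \<inter> exps I = {}"
  proof (rule ccontr)
    assume "box u (Z i) \<inter> exps I \<noteq> {}"
    then obtain v where v: "v \<in> box u (Z i)" "v \<in> exps I"
      by blast
    then obtain d where "Abs_poly_mapping v = d + b" "Poly_Mapping.keys d \<subseteq> Z i"
      using lookup_in_box_iff[of "Abs_poly_mapping v" b "Z i"] b by auto
    then have d: "v = Poly_Mapping.lookup (d + b)" "Poly_Mapping.keys d \<subseteq> Z i"
      by (metis lookup_Abs_finite, simp)
    have "monomial (d + p) * g i \<in> supported (exps I)"
    proof -
      have "Poly_Mapping.keys (g i * monomial (d + p)) = {d + b}"
        by (simp add: keys_times_monomial keys_g pq(1) algebra_simps)
      then show ?thesis
        using v(2) d(1) by (simp add: supported_def mult.commute)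
    qed
    then have "monomial (d + p) * g i \<in> I"
      using I by blast
    then have "monomial (d + p) \<odot>\<^bsub>?M\<^esub> m i = \<zero>\<^bsub>?M\<^esub>"
      using coset_eq_iff[OF ideal, of _ 0] by (simp add: g(1)[OF i(1)] S)
    moreover have "Poly_Mapping.keys (d + p) \<subseteq> Z i"
      using d(2) f(1)[OF i(1)] pq(2) keys_add[of d p] by (auto simp: subpoly_def)
    moreover have "m i \<in> carrier ?M"
      by (simp add: g(1)[OF i(1)] S)
    ultimately have "m i = \<zero>\<^bsub>?M\<^esub>"
      using free_stanley_space_no_torsion[OF module_quotient_module[OF ideal] _ D_i(2)[OF i(1)]]
      by blast
    then have "g i \<in> I"
      using coset_eq_iff[OF ideal, of "g i" 0] by (simp add: g(1)[OF i(1)] S)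
    then have "g i \<in> supported (exps I)"
      using I by blast
    then have "monomial q \<in> I"
      using keys_g by (simp add: supported_def)
    then have "monomial b \<in> I"
      using ideal_poly_ringD(3)[OF ideal, of "monomial q" "monomial p"] by (simp add: monomial_mult pq(1))
    then show False
      using u b by simp
  qed
  then show ?thesis
    using nth_mem[OF i(1)] by (auto simp: Z_def split_beta)
qed

section \<open>Stanley depth and depth\<close>

text \<open>The bound by the number of variables gives meaning to the \<open>Max\<close> in
  \<open>sdepth\<close>.\<close>

lemma finite_sdepth_set:
  fixes M :: "(('v::finite, 'k::field) mpoly, 'm) module"
  shows "finite {sdepth_decomposition D | D. stanley_decomposition M G D}"
proof (rule finite_subset)
  show "{sdepth_decomposition D | D. stanley_decomposition M G D} \<subseteq> {..card (UNIV :: 'v set)}"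
  proof
    fix d assume "d \<in> {sdepth_decomposition D | D. stanley_decomposition M G D}"
    then obtain D where D: "stanley_decomposition M G D" "d = sdepth_decomposition D"
      by blast
    from D(1) obtain m Z where "(m, Z) \<in> set D"
      by (metis hd_in_set stanley_decomposition_def prod.collapse)
    then have "d \<le> card Z"
      unfolding D(2) sdepth_decomposition_def by (intro Min_le) force+
    also have "\<dots> \<le> card (UNIV :: 'v set)"
      by (simp add: card_mono)
    finally show "d \<in> {..card (UNIV :: 'v set)}"
      by simp
  qed
qed simp

lemma sdepth_ge:
  assumes "stanley_decomposition M G D" "\<And>m Z. (m, Z) \<in> set D \<Longrightarrow> d \<le> card Z"
  shows "d \<le> sdepth M G"
proof -
  have "d \<le> sdepth_decomposition D"
    using assms unfolding sdepth_decomposition_def stanley_decomposition_def by (subst Min_ge_iff) auto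
  also have "\<dots> \<le> sdepth M G"
    unfolding sdepth_def using assms(1) by (intro Max_ge finite_sdepth_set) auto
  finally show ?thesis .
qed

text \<open>The given decomposition serves to make the set under \<open>Max\<close>
  nonempty.\<close>

lemma sdepth_attained:
  assumes "stanley_decomposition M G D"
  obtains D' where "stanley_decomposition M G D'" "\<And>m Z. (m, Z) \<in> set D' \<Longrightarrow> sdepth M G \<le> card Z"
proof -
  have "sdepth M G \<in> {sdepth_decomposition D | D. stanley_decomposition M G D}"
    unfolding sdepth_def using assms by (intro Max_in finite_sdepth_set) auto
  then obtain D' where D': "stanley_decomposition M G D'" "sdepth M G = sdepth_decomposition D'"
    by auto
  have "sdepth M G \<le> card Z" if "(m, Z) \<in> set D'" for m Z
    unfolding D'(2) sdepth_decomposition_def using that by (intro Min_le) force+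
  with D'(1) show ?thesis
    using that by blast
qed

lemma (in monomial_module) sdepth_ge_box_partition:
  assumes "box_partition P T" "T \<noteq> {}" "\<And>a Z. (a, Z) \<in> P \<Longrightarrow> d \<le> card Z"
  shows "d \<le> sdepth M G"
proof -
  obtain D where D: "stanley_decomposition M G D" "snd ` set D = snd ` P"
    using stanley_decomposition_exists[OF assms(1,2)] by (elim exE conjE)
  have "d \<le> card Z" if "(m, Z) \<in> set D" for m Z
  proof -
    have "Z \<in> snd ` P"
      using that D(2) by force
    then show ?thesis
      using assms(3) by auto
  qed
  with D(1) show ?thesis
    by (rule sdepth_ge)
qed

section \<open>Regular sequences on an ideal\<close>

lemma seq_submodule_Nil:
  fixes I :: "('v, 'k::comm_ring_1) mpoly set"
  assumes "ideal I poly_ring"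
  shows "seq_submodule (ideal_module poly_ring I) [] = {0}"
proof -
  interpret Module.module poly_ring "ideal_module poly_ring I"
    by (rule module_ideal_module) fact
  show ?thesis
    by (simp add: seq_submodule_def)
qed

lemma seq_submodule_singleton:
  fixes I :: "('v, 'k::comm_ring_1) mpoly set"
  assumes "ideal I poly_ring"
  shows "seq_submodule (ideal_module poly_ring I) [f] = (*) f ` I"
proof -
  interpret Module.module poly_ring "ideal_module poly_ring I"
    by (rule module_ideal_module) fact
  have "(\<Oplus>\<^bsub>ideal_module poly_ring I\<^esub>j\<in>{0::nat}. [f] ! j * y j) = f * y 0" if "y 0 \<in> I" for y
    using ideal_poly_ringD(3)[OF assms that, of f] M.finsum_insert[of "{}" 0 "\<lambda>j. [f] ! j * y j"] by simp
  then have *: "(\<Oplus>\<^bsub>ideal_module poly_ring I\<^esub>j\<in>{..<length [f]}. [f] ! j * y j) = f * y 0"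
    if "y \<in> {..<length [f]} \<rightarrow> I" for y
    using that by (auto simp: lessThan_Suc)
  show ?thesis
  proof (intro subset_antisym subsetI)
    fix x assume "x \<in> seq_submodule (ideal_module poly_ring I) [f]"
    then obtain y where "y \<in> {..<length [f]} \<rightarrow> I" "x = f * y 0"
      unfolding seq_submodule_def using * by auto
    then show "x \<in> (*) f ` I"
      by auto
  next
    fix x assume "x \<in> (*) f ` I"
    then obtain h where h: "h \<in> I" "x = f * h"
      by blast
    then show "x \<in> seq_submodule (ideal_module poly_ring I) [f]"
      unfolding seq_submodule_def using *[of "\<lambda>_. h"]
      by (intro CollectI exI[of _ "\<lambda>_. h"]) auto
  qed
qed

lemma var_in_max_ideal: "var i \<in> max_ideal"
  unfolding max_ideal_def using ring.genideal_self[OF ring_poly_ring, of "range var"] by auto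

text \<open>A monomial of \<open>I\<close> with least exponent at \<open>i\<close> is not in x_i I.
  The linear order on the variables orders the exponents, so that products of nonzero polynomials
  are nonzero.\<close>

lemma regular_sequence_var:
  fixes I :: "('v::{finite, linorder}, 'k::field) mpoly set"
  assumes ideal: "ideal I poly_ring" and I: "I = supported (exps I)" and "I \<noteq> {0}"
  shows "regular_sequence (ideal_module poly_ring I) [var i]"
proof -
  have "exps I \<noteq> {}"
    using I \<open>I \<noteq> {0}\<close> supported_empty by metis
  define k where "k = (LEAST k. \<exists>u \<in> exps I. u i = k)"
  have "\<exists>u \<in> exps I. u i = k"
    unfolding k_def by (rule LeastI_ex) (use \<open>exps I \<noteq> {}\<close> in auto)
  then obtain b where b: "monomial b \<in> I" "Poly_Mapping.lookup b i = k"
    by (auto simp: exps_def)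
  have k_le: "k \<le> Poly_Mapping.lookup c i" if "monomial c \<in> I" for c
    unfolding k_def using that by (intro Least_le) (force simp: exps_iff[symmetric] simp del: exps_iff)
  have "monomial b \<notin> (*) (var i) ` I"
  proof
    assume "monomial b \<in> (*) (var i) ` I"
    then obtain f where f: "f \<in> I" "monomial b = f * var i"
      by (auto simp: mult.commute)
    have "{b} = Poly_Mapping.keys (monomial b :: ('v, 'k) mpoly)"
      by (simp add: monomial_def)
    also have "\<dots> = (\<lambda>c. c + Poly_Mapping.single i 1) ` Poly_Mapping.keys f"
      unfolding f(2) var_def by (rule keys_times_monomial)
    finally have "{b} = (\<lambda>c. c + Poly_Mapping.single i 1) ` Poly_Mapping.keys f" .
    then obtain c where c: "c \<in> Poly_Mapping.keys f" "b = c + Poly_Mapping.single i 1"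
      by auto
    have "monomial c \<in> I"
      using f(1) c(1) I exps_iff unfolding supported_def by blast
    then show False
      using k_le[of c] b(2) c(2) by (simp add: lookup_add)
  qed
  then have "(*) (var i) ` I \<noteq> I"
    using b(1) by blast
  moreover have "(var i :: ('v, 'k) mpoly) \<noteq> 0"
    by (simp add: var_def monomial_def flip: keys_eq_empty)
  ultimately show ?thesis
    by (simp add: regular_sequence_def seq_submodule_Nil[OF ideal] seq_submodule_singleton[OF ideal])
qed

lemma depth_ideal_module_eq_1:
  fixes I :: "('v::{finite, linorder}, 'k::field) mpoly set"
  assumes ideal: "ideal I poly_ring" and I: "I = supported (exps I)" and "I \<noteq> {0}"
    and u: "u \<notin> I" "\<And>i. var i * u \<in> I"
  shows "depth (ideal_module poly_ring I) = 1"
proof (rule antisym)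
  \<comment> \<open>The multipliers taking \<open>u\<close> into \<open>I\<close> form an ideal that
    contains the variables.\<close>
  have max_u: "f * u \<in> I" if "f \<in> max_ideal" for f
  proof -
    have "ideal {f. f * u \<in> I} poly_ring"
      using ideal_poly_ringD[OF ideal] by (intro ideal_poly_ringI) (auto simp: distrib_right mult.assoc)
    moreover have "range var \<subseteq> {f. f * u \<in> I}"
      using u(2) by auto
    ultimately have "max_ideal \<subseteq> {f. f * u \<in> I}"
      unfolding max_ideal_def by (rule ring.genideal_minimal[OF ring_poly_ring])
    then show ?thesis
      using that by blast
  qed
  have "length fs \<le> 1"
    if fs: "set fs \<subseteq> max_ideal" "regular_sequence (ideal_module poly_ring I) fs" for fs
  proof (rule ccontr)
    assume "\<not> length fs \<le> 1"
    then obtain f g hs where fgh: "fs = f # g # hs"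
      by (metis One_nat_def Suc_le_eq le_Suc_eq length_0_conv length_Suc_conv neq_Nil_conv not_less_eq_eq zero_le)
    have f: "f * y = 0 \<Longrightarrow> y = 0" if "y \<in> I" for y
      using fs(2) that unfolding regular_sequence_def fgh by (force simp: seq_submodule_Nil[OF ideal])
    have g: "g * y \<in> (*) f ` I \<Longrightarrow> y \<in> (*) f ` I" if "y \<in> I" for y
      using fs(2) that unfolding regular_sequence_def fgh
      by (force simp: seq_submodule_singleton[OF ideal])
    \<comment> \<open>Otherwise \<open>f\<close> would annihilate a nonzero element of
      \<open>I\<close>.\<close>
    have "f \<noteq> 0"
      using f \<open>I \<noteq> {0}\<close> ideal_poly_ringD(1)[OF ideal] by auto
    have "g * (f * u) = f * (g * u)"
      by (simp add: ac_simps)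
    \<comment> \<open>Both \<open>f * u\<close> and \<open>g * u\<close> lie in \<open>I\<close>, so
      regularity of \<open>g\<close> modulo f I applies; cancelling \<open>f\<close> then puts
      \<open>u\<close> into \<open>I\<close>.\<close>
    then have "f * u \<in> (*) f ` I"
      using fs(1) max_u by (intro g[of "f * u"]) (auto simp: fgh)
    then show False
      using \<open>f \<noteq> 0\<close> u(1) by auto
  qed
  then show "depth (ideal_module poly_ring I) \<le> 1"
    unfolding depth_def by (intro Sup_least) (auto simp: one_enat_def)
  have "enat (length [var undefined :: ('v, 'k) mpoly]) \<le> depth (ideal_module poly_ring I)"
    unfolding depth_def
    using regular_sequence_var[OF ideal I \<open>I \<noteq> {0}\<close>] var_in_max_ideal
    by (intro Sup_upper) fastforce
  then show "1 \<le> depth (ideal_module poly_ring I)"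
    by (simp add: one_enat_def)
qed

section \<open>Comparison of the two Stanley depths\<close>

theorem corollary3p3:
  fixes I :: "(3, 'k::field) mpoly set"
  assumes "monomial_ideal I" "I \<noteq> {0}" "I \<noteq> UNIV"
  shows "sdepth (ideal_module poly_ring I) (ideal_component I)
           \<ge> sdepth (quotient_module poly_ring I) (quotient_component I) + 1 \<and>
         (sdepth (ideal_module poly_ring I) (ideal_component I) = 1 \<longrightarrow>
           depth (ideal_module poly_ring I) = 1)"
proof -
  let ?sI = "sdepth (ideal_module poly_ring I) (ideal_component I)"
  let ?sQ = "sdepth (quotient_module poly_ring I) (quotient_component I)"
  note ideal = monomial_ideal_ideal[OF assms(1)]
  note I = monomial_ideal_eq_supported[OF assms(1)]
  note up = upset_exps[OF ideal]
  interpret ideal: monomial_module "ideal_module poly_ring I" "ideal_component I" "exps I" "\<lambda>f. f"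
    by (rule ideal_monomial_module[OF ideal I])
  interpret quot: monomial_module "quotient_module poly_ring I" "quotient_component I" "- exps I" "coset I"
    by (rule quotient_monomial_module[OF ideal I])
  have nonempty: "exps I \<noteq> {}"
    using I assms(2) supported_empty by metis
  have "exps I \<noteq> UNIV"
    using I assms(3) supported_UNIV by metis
  have card3: "card (UNIV :: 3 set) = 3"
    by simp
  obtain N where N: "\<And>u. trunc N u \<in> exps I \<longleftrightarrow> u \<in> exps I"
    using upset_trunc[OF up] by blast
  \<comment> \<open>Some decomposition of S/I is needed before its Stanley depth can be known to be
    attained. Invariance under truncation passes to the complement.\<close>
  then obtain P where "box_partition P (- exps I)"
    using box_partition_exists[of N "- exps I"] by auto
  then obtain D0 where "stanley_decomposition (quotient_module poly_ring I) (quotient_component I) D0"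
    using quot.stanley_decomposition_exists \<open>exps I \<noteq> UNIV\<close> by blast
  then obtain D where D: "stanley_decomposition (quotient_module poly_ring I) (quotient_component I) D"
    "\<And>m Z. (m, Z) \<in> set D \<Longrightarrow> ?sQ \<le> card Z"
    by (rule sdepth_attained) blast
  have box: "\<exists>Z. ?sQ \<le> card Z \<and> box u Z \<inter> exps I = {}" if "u \<notin> exps I" for u
    using quotient_stanley_decomposition_box[OF ideal I D(1) that] D(2) by blast
  have saturated_2: "2 \<le> ?sI" if "\<And>u. u \<notin> exps I \<Longrightarrow> \<exists>i. u(i := Suc (u i)) \<notin> exps I"
    using saturated_upset_box_partition[OF up card3 that] ideal.sdepth_ge_box_partition[OF _ nonempty]
    by fastforce
  \<comment> \<open>Exponent 0 is outside the proper ideal, and its box in all three directions is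
    everything, so it meets the nonzero ideal.\<close>
  have Q_le: "?sQ \<le> 2"
  proof -
    obtain u where "u \<notin> exps I"
      using \<open>exps I \<noteq> UNIV\<close> by blast
    define w where "w = (\<lambda>_ :: 3. 0 :: nat)"
    have "w \<notin> exps I"
      using upsetD[OF up, of w u] \<open>u \<notin> exps I\<close> by (auto simp: w_def)
    then obtain Z where Z: "?sQ \<le> card Z" "box w Z \<inter> exps I = {}"
      using box by blast
    have "Z \<noteq> UNIV"
      using Z(2) nonempty by (auto simp: box_def w_def)
    then have "card Z < 3"
      using psubset_card_mono[of UNIV Z] card3 by auto
    then show ?thesis
      using Z(1) by simp
  qed
  consider "?sQ = 0" | "?sQ = 1" | "?sQ = 2"
    using Q_le by linarith
  then have "?sI \<ge> ?sQ + 1"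
  proof cases
    case 1
    obtain P where "box_partition P (exps I)" "\<And>a Z. (a, Z) \<in> P \<Longrightarrow> 1 \<le> card Z"
      using upset_box_partition_pos[OF up] by blast
    then show ?thesis
      using ideal.sdepth_ge_box_partition[OF _ nonempty] 1 by simp
  next
    case 2
    \<comment> \<open>A box of positive dimension contains a neighbour of its corner.\<close>
    have "\<exists>i. u(i := Suc (u i)) \<notin> exps I" if u: "u \<notin> exps I" for u
    proof -
      obtain Z where Z: "1 \<le> card Z" "box u Z \<inter> exps I = {}"
        using box[OF u] 2 by auto
      then obtain i where "i \<in> Z"
        by fastforce
      then have "u(i := Suc (u i)) \<in> box u Z"
        by (auto simp: box_def)
      then show ?thesis
        using Z(2) by blast
    qed
    then show ?thesis
      using saturated_2 2 by simp
  next
    case 3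
    have "\<exists>Z. card (UNIV :: 3 set) \<le> card Z + 1 \<and> box u Z \<inter> exps I = {}" if "u \<notin> exps I" for u
      using box[OF that] 3 card3 by auto
    \<comment> \<open>Here \<open>I\<close> is principal, so a single box of dimension 3
      suffices.\<close>
    then obtain a where "exps I = box a UNIV"
      using upset_eq_box_UNIV[OF up nonempty] by blast
    then show ?thesis
      using ideal.sdepth_ge_box_partition[OF _ nonempty, of "{(a, UNIV)}" 3] 3
        box_partition_singleton[of a UNIV] by simp
  qed
  moreover have "depth (ideal_module poly_ring I) = 1" if sI: "?sI = 1"
  proof -
    \<comment> \<open>The contrapositive of \<open>saturated_2\<close>: x^v is a socle monomial of
      S/I.\<close>
    obtain v where v: "v \<notin> exps I" "\<And>i. v(i := Suc (v i)) \<in> exps I"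
      using saturated_2 sI by fastforce
    obtain b where b: "v = Poly_Mapping.lookup b"
      by (metis lookup_Abs_finite)
    have "var i * monomial b \<in> I" for i
    proof -
      have "v(i := Suc (v i)) = Poly_Mapping.lookup (Poly_Mapping.single i 1 + b)"
        by (auto simp: b lookup_add lookup_single when_def fun_eq_iff)
      then have "monomial (Poly_Mapping.single i 1 + b) \<in> I"
        using v(2)[of i] exps_iff by metis
      then show ?thesis
        by (simp add: var_def monomial_mult)
    qed
    moreover have "monomial b \<notin> I"
      using v(1) b by simp
    ultimately show ?thesis
      by (intro depth_ideal_module_eq_1[OF ideal I assms(2)])
  qed
  ultimately show ?thesis
    by blast
qed

end
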